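(* Let $G=(V,E)$ be a cyclically 4-connected cubic non-hamiltonian graph, let $v\in V$ have neighbours $w_1,w_2,w_3$, and let $e=\{x,y\}\in E$ be such that $d(v,x)\ge 3$, $d(v,y)\ge 3$, and for every cyclic edge cut $C$ of $G$ with $|C|=4$, neither $v$ nor $x$ is an endpoint of an edge of $C$ and $v$ and $x$ lie in different components of $G\setminus C$. Let $M$ be a 3-edge-connected cubic multigraph. Then the graph $\mathcal{T}(G,v,e,M)$ is cyclically 5-connected and non-hamiltonian.
   Context: $d(\cdot,\cdot)$ is graph distance. A cyclic edge cut is an edge set whose removal leaves (at least) two components each containing a cycle; a cubic graph is cyclically $k$-connected if it has no cyclic edge cut with fewer than $k$ edges. Construction of $\mathcal{T}(G,v,e,M)$: A brick is a copy of $G$ with the vertex $v$ deleted and the edge $\{x,y\}$ deleted; in a brick the copies of $w_1,w_2,w_3,x,y$ have degree 2. A triple is formed from three bricks $B_1,B_2,B_3$ (with copies $w_{i,1},w_{i,2},w_{i,3},x_i,y_i$ in $B_i$) and three new vertices $z_1,z_2,z_3$, where $z_j$ is joined to $w_{i,j}$ for all $i,j\in\{1,2,3\}$. To form $\mathcal{T}(G,v,e,M)$, replace every vertex $u$ of $M$ by a triple and assign the three bricks of that triple bijectively to the three edges of $M$ incident with $u$. For each edge of $M$, it has two assigned bricks $B$ and $B'$ (from the triples of its two endpoints); add the edges joining the $x$-vertex of $B$ to the $y$-vertex of $B'$ and the $x$-vertex of $B'$ to the $y$-vertex of $B$. The result is cubic. *)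

theory Defs
  imports "HOL-Library.Extended_Nat"
begin

section \<open>Simple graphs\<close>

record 'a ugraph =
  verts :: "'a set"
  edges :: "'a set set"

definition simple_graph :: "'a ugraph \<Rightarrow> bool" where
  "simple_graph G \<longleftrightarrow> finite (verts G) \<and> (\<forall>f\<in>edges G. f \<subseteq> verts G \<and> card f = 2)"

definition neighbours :: "'a ugraph \<Rightarrow> 'a \<Rightarrow> 'a set" where
  "neighbours G a = {b. {a, b} \<in> edges G}"

definition cubic_graph :: "'a ugraph \<Rightarrow> bool" where
  "cubic_graph G \<longleftrightarrow> simple_graph G \<and> (\<forall>a\<in>verts G. card {f\<in>edges G. a \<in> f} = 3)"

definition delete_edges :: "'a ugraph \<Rightarrow> 'a set set \<Rightarrow> 'a ugraph" where
  "delete_edges G C = G\<lparr>edges := edges G - C\<rparr>"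

text \<open>Walks are given by their nonempty vertex lists.\<close>

definition walk :: "'a ugraph \<Rightarrow> 'a list \<Rightarrow> bool" where
  "walk G p \<longleftrightarrow> p \<noteq> [] \<and> set p \<subseteq> verts G \<and>
     (\<forall>i. Suc i < length p \<longrightarrow> {p ! i, p ! Suc i} \<in> edges G)"

text \<open>The distance is \<open>\<infinity>\<close> if there is no connecting walk.\<close>

definition distance :: "'a ugraph \<Rightarrow> 'a \<Rightarrow> 'a \<Rightarrow> enat" where
  "distance G a b = (INF p\<in>{p. walk G p \<and> hd p = a \<and> last p = b}. enat (length p - 1))"

definition cycle :: "'a ugraph \<Rightarrow> 'a list \<Rightarrow> bool" where
  "cycle G p \<longleftrightarrow> walk G p \<and> distinct p \<and> length p \<ge> 3 \<and> {last p, hd p} \<in> edges G"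

definition hamiltonian :: "'a ugraph \<Rightarrow> bool" where
  "hamiltonian G \<longleftrightarrow> (\<exists>p. cycle G p \<and> set p = verts G)"

definition component :: "'a ugraph \<Rightarrow> 'a \<Rightarrow> 'a set" where
  "component G a = {b. \<exists>p. walk G p \<and> hd p = a \<and> last p = b}"

definition components :: "'a ugraph \<Rightarrow> 'a set set" where
  "components G = component G ` verts G"

definition cyclic_edge_cut :: "'a ugraph \<Rightarrow> 'a set set \<Rightarrow> bool" where
  "cyclic_edge_cut G C \<longleftrightarrow> C \<subseteq> edges G \<and>
     (\<exists>A\<in>components (delete_edges G C). \<exists>B\<in>components (delete_edges G C). A \<noteq> B \<and>
        (\<exists>p. cycle (delete_edges G C) p \<and> set p \<subseteq> A) \<and>
        (\<exists>q. cycle (delete_edges G C) q \<and> set q \<subseteq> B))"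

text \<open>Cyclic connectivity is a notion for cubic graphs only, hence the first conjunct.\<close>

definition cyclically_connected :: "nat \<Rightarrow> 'a ugraph \<Rightarrow> bool" where
  "cyclically_connected k G \<longleftrightarrow>
     cubic_graph G \<and> \<not> (\<exists>C. cyclic_edge_cut G C \<and> card C < k)"


section \<open>Multigraphs\<close>

text \<open>Parallel edges and loops are allowed; a loop has a singleton set of ends.\<close>

record ('u, 'f) mgraph =
  mverts :: "'u set"
  medges :: "'f set"
  ends :: "'f \<Rightarrow> 'u set"

definition multigraph :: "('u, 'f) mgraph \<Rightarrow> bool" where
  "multigraph M \<longleftrightarrow> finite (mverts M) \<and> finite (medges M) \<and>
     (\<forall>f\<in>medges M. ends M f \<subseteq> mverts M \<and> (card (ends M f) = 1 \<or> card (ends M f) = 2))"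

definition incident_edges :: "('u, 'f) mgraph \<Rightarrow> 'u \<Rightarrow> 'f set" where
  "incident_edges M u = {f\<in>medges M. u \<in> ends M f}"

text \<open>Loops count twice.\<close>

definition mdegree :: "('u, 'f) mgraph \<Rightarrow> 'u \<Rightarrow> nat" where
  "mdegree M u = card (incident_edges M u) + card {f\<in>medges M. ends M f = {u}}"

definition cubic_multigraph :: "('u, 'f) mgraph \<Rightarrow> bool" where
  "cubic_multigraph M \<longleftrightarrow> multigraph M \<and> (\<forall>u\<in>mverts M. mdegree M u = 3)"

definition mconnected :: "('u, 'f) mgraph \<Rightarrow> bool" where
  "mconnected M \<longleftrightarrow> mverts M \<noteq> {} \<and>
     (\<forall>a\<in>mverts M. \<forall>b\<in>mverts M. (a, b) \<in> {(c, d). \<exists>f\<in>medges M. ends M f = {c, d}}\<^sup>*)"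

definition edge_connected :: "nat \<Rightarrow> ('u, 'f) mgraph \<Rightarrow> bool" where
  "edge_connected k M \<longleftrightarrow>
     (\<forall>S\<subseteq>medges M. card S < k \<longrightarrow> mconnected (M\<lparr>medges := medges M - S\<rparr>))"


section \<open>The construction \<open>\<T>(G,v,e,M)\<close>\<close>

definition brick :: "'a ugraph \<Rightarrow> 'a \<Rightarrow> 'a set \<Rightarrow> 'a ugraph" where
  "brick G v e = \<lparr>verts = verts G - {v}, edges = {f\<in>edges G. v \<notin> f} - {e}\<rparr>"

text \<open>
  \<open>Copy u i a\<close> is the copy of the vertex \<open>a\<close> in the brick \<open>B\<^sub>i\<close> of the triple replacing the
  vertex \<open>u\<close> of \<open>M\<close>, and \<open>Hub u j\<close> is the vertex \<open>z\<^sub>j\<close> of that triple.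
\<close>

datatype ('a, 'u) tvertex = Copy 'u nat 'a | Hub 'u nat

text \<open>The brick \<open>B\<^sub>i\<close> of the triple at \<open>u\<close> is assigned to the edge \<open>\<sigma> u i\<close> of \<open>M\<close>.\<close>

definition brick_assignment :: "('u, 'f) mgraph \<Rightarrow> ('u \<Rightarrow> nat \<Rightarrow> 'f) \<Rightarrow> bool" where
  "brick_assignment M \<sigma> \<longleftrightarrow> (\<forall>u\<in>mverts M. bij_betw (\<sigma> u) {1, 2, 3} (incident_edges M u))"

text \<open>
  The neighbours of \<open>v\<close> are \<open>w 1\<close>, \<open>w 2\<close>, \<open>w 3\<close>, and \<open>e = {x, y}\<close>. In the last set of edges the
  roles of \<open>(u, i)\<close> and \<open>(u', i')\<close> may be exchanged, so each edge of \<open>M\<close> yields two edges.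
  Loops need no clause: a 3-edge-connected cubic multigraph has none.
\<close>

definition triple_graph ::
  "'a ugraph \<Rightarrow> 'a \<Rightarrow> (nat \<Rightarrow> 'a) \<Rightarrow> 'a \<Rightarrow> 'a \<Rightarrow> ('u, 'f) mgraph \<Rightarrow> ('u \<Rightarrow> nat \<Rightarrow> 'f)
    \<Rightarrow> ('a, 'u) tvertex ugraph" where
  "triple_graph G v w x y M \<sigma> =
    \<lparr>verts =
       {Copy u i a | u i a. u \<in> mverts M \<and> i \<in> {1, 2, 3} \<and> a \<in> verts (brick G v {x, y})} \<union>
       {Hub u j | u j. u \<in> mverts M \<and> j \<in> {1, 2, 3}},
     edges =
       {Copy u i ` f | u i f. u \<in> mverts M \<and> i \<in> {1, 2, 3} \<and> f \<in> edges (brick G v {x, y})} \<union>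
       {{Hub u j, Copy u i (w j)} | u i j. u \<in> mverts M \<and> i \<in> {1, 2, 3} \<and> j \<in> {1, 2, 3}} \<union>
       {{Copy u i x, Copy u' i' y} | u u' i i' f.
          f \<in> medges M \<and> ends M f = {u, u'} \<and> u \<noteq> u' \<and>
          i \<in> {1, 2, 3} \<and> i' \<in> {1, 2, 3} \<and> \<sigma> u i = f \<and> \<sigma> u' i' = f}\<rparr>"

end

theory Submission
  imports Defs
begin

text \<open>
  In a cubic graph, \<open>3 |S| = 2 e(S) + d(S)\<close>, so for \<open>d(S) \<le> 4\<close> the set \<open>S\<close> spans a cycle iff
  \<open>|S| \<ge> 3\<close>. Cyclic connectivity thus becomes a statement about the sizes \<open>d(S)\<close> of the cuts of
  vertex sets with at least three vertices on each side.

  Cyclic 5-connectivity: every vertex set meets each triple in a sparse set or in the complement of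
  one, where a sparse set has at least as many cut edges inside the triple as it has ends of linking
  edges. Rounding each triple to its larger side therefore does not increase the cut. If the rounded
  set is proper, 3-edge-connectivity of \<open>M\<close> gives at least 6 cut edges; otherwise one side of the
  cut is sparse in every triple, and a cut of size at most 4 is excluded by the hypotheses on the
  4-cuts of \<open>G\<close>.

  Non-hamiltonicity: let \<open>F\<close> be the edge set of a hamiltonian cycle. Each hub lies on two edges of
  \<open>F\<close>, so 6 of the hub edges of a triple are in \<open>F\<close> and some brick has an even number of them, and
  hence by parity also an even number of linking edges in \<open>F\<close>. Since \<open>G\<close> is not hamiltonian, this
  number is 2 and \<open>F\<close> joins the vertices \<open>x\<close> and \<open>y\<close> of the brick inside the brick. The partner
  brick has the same two linking edges and behaves in the same way, so \<open>F\<close> has a closed component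
  inside the two bricks.
\<close>

section \<open>Edge cuts in simple graphs\<close>

definition crosses :: "'a set \<Rightarrow> 'a set \<Rightarrow> bool" where
  "crosses S f \<longleftrightarrow> f \<inter> S \<noteq> {} \<and> \<not> f \<subseteq> S"

definition boundary :: "'a ugraph \<Rightarrow> 'a set \<Rightarrow> 'a set set" where
  "boundary G S = {f \<in> edges G. crosses S f}"

lemma crosses_doubleton [simp]: "crosses S {a, b} \<longleftrightarrow> (a \<in> S) \<noteq> (b \<in> S)"
  by (auto simp: crosses_def)

lemma simple_graph_edgeE:
  assumes "simple_graph G" "f \<in> edges G"
  obtains a b where "f = {a, b}" "a \<noteq> b" "a \<in> verts G" "b \<in> verts G"
proof -
  have "card f = 2" "f \<subseteq> verts G"
    using assms by (auto simp: simple_graph_def)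
  then show ?thesis
    using that by (auto simp: card_2_iff)
qed

lemma simple_graph_finite_edges:
  assumes "simple_graph G"
  shows "finite (edges G)"
proof -
  have "edges G \<subseteq> Pow (verts G)"
    using assms by (auto simp: simple_graph_def)
  then show ?thesis
    using assms finite_subset by (auto simp: simple_graph_def)
qed

lemma simple_graph_edge_verts:
  assumes "simple_graph G" "{a, b} \<in> edges G"
  shows "a \<in> verts G" "b \<in> verts G" "a \<noteq> b"
  using assms by (auto simp: simple_graph_def dest!: bspec[of _ _ "{a, b}"])

lemma finite_boundary: "simple_graph G \<Longrightarrow> finite (boundary G S)"
  by (simp add: boundary_def simple_graph_finite_edges)

lemma boundary_compl:
  assumes "simple_graph G"
  shows "boundary G (verts G - S) = boundary G S"
proof -
  have "crosses (verts G - S) f \<longleftrightarrow> crosses S f" if f: "f \<in> edges G" for f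
  proof -
    obtain a b where "f = {a, b}" "a \<in> verts G" "b \<in> verts G"
      using simple_graph_edgeE[OF assms f] by blast
    then show ?thesis
      by auto
  qed
  then show ?thesis
    by (auto simp: boundary_def)
qed

lemma card_eq_sum_of_bool: "finite E \<Longrightarrow> card {f \<in> E. P f} = (\<Sum>f\<in>E. of_bool (P f))"
  by (simp add: Int_def)

text \<open>Count incident pairs edge by edge: an edge inside \<open>S\<close> has two ends there,
  an edge crossing \<open>S\<close> has one. It serves cubic graphs and, later, the 2-regular graph
  formed by a hamiltonian cycle.\<close>

lemma handshake:
  assumes G: "simple_graph G" and S: "S \<subseteq> verts G"
  shows "(\<Sum>a\<in>S. card {f \<in> edges G. a \<in> f}) = 2 * card {f \<in> edges G. f \<subseteq> S} + card (boundary G S)"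
proof -
  have finE: "finite (edges G)"
    using G by (rule simple_graph_finite_edges)
  have finS: "finite S"
    using G S finite_subset by (auto simp: simple_graph_def)
  have "(\<Sum>a\<in>S. card {f \<in> edges G. a \<in> f}) = (\<Sum>f\<in>edges G. \<Sum>a\<in>S. of_bool (a \<in> f))"
    by (subst sum.swap) (simp only: card_eq_sum_of_bool[OF finE])
  also have "\<dots> = (\<Sum>f\<in>edges G. 2 * of_bool (f \<subseteq> S) + of_bool (crosses S f))"
  proof (rule sum.cong)
    fix f assume f: "f \<in> edges G"
    obtain a b where ab: "f = {a, b}" "a \<noteq> b"
      using simple_graph_edgeE[OF G f] by metis
    have 1: "(\<Sum>a\<in>S. of_bool (a \<in> f) :: nat) = card {c \<in> S. c \<in> f}"
      by (rule card_eq_sum_of_bool[OF finS, symmetric])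
    have 2: "{c \<in> S. c \<in> f} = {a, b} \<inter> S"
      using ab by auto
    show "(\<Sum>a\<in>S. of_bool (a \<in> f) :: nat) = 2 * of_bool (f \<subseteq> S) + of_bool (crosses S f)"
      unfolding 1 2 using ab by (cases "a \<in> S"; cases "b \<in> S") auto
  qed simp
  also have "\<dots> = 2 * card {f \<in> edges G. f \<subseteq> S} + card (boundary G S)"
    by (simp only: boundary_def card_eq_sum_of_bool[OF finE] sum.distrib sum_distrib_left)
  finally show ?thesis .
qed

section \<open>Walks, components and cycles\<close>

lemma walk_Cons:
  "walk G (a # p) \<longleftrightarrow> a \<in> verts G \<and> (p = [] \<or> {a, hd p} \<in> edges G \<and> walk G p)"
proof (cases p)
  case Nil
  then show ?thesis
    by (simp add: walk_def)
next
  case (Cons b q)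
  have *: "(\<forall>i. Q i) \<longleftrightarrow> Q 0 \<and> (\<forall>i. Q (Suc i))" for Q
    by (metis not0_implies_Suc)
  have "(\<forall>i. Suc i < length (a # p) \<longrightarrow> {(a # p) ! i, (a # p) ! Suc i} \<in> edges G) \<longleftrightarrow>
    {a, hd p} \<in> edges G \<and> (\<forall>i. Suc i < length p \<longrightarrow> {p ! i, p ! Suc i} \<in> edges G)"
    unfolding Cons by (subst *) auto
  then show ?thesis
    using Cons by (auto simp: walk_def)
qed

lemma walk_take: "walk G p \<Longrightarrow> walk G (take (Suc n) p)"
  using set_take_subset[of "Suc n" p] by (auto simp: walk_def)

lemma walk_snoc:
  assumes "walk G p" "{last p, b} \<in> edges G" "b \<in> verts G"
  shows "walk G (p @ [b])"
proof -
  have "{(p @ [b]) ! i, (p @ [b]) ! Suc i} \<in> edges G" if "Suc i < length (p @ [b])" for i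
  proof (cases "Suc i = length p")
    case True
    then have "last p = p ! i"
      by (metis assms(1) diff_Suc_1 last_conv_nth walk_def)
    then show ?thesis
      using True assms(2) by (auto simp: nth_append)
  next
    case False
    then show ?thesis
      using that assms(1) by (auto simp: nth_append walk_def)
  qed
  then show ?thesis
    using assms by (auto simp: walk_def)
qed

lemma walk_closed:
  assumes "walk G p" "hd p \<in> K" "\<And>a b. {a, b} \<in> edges G \<Longrightarrow> a \<in> K \<Longrightarrow> b \<in> K"
  shows "set p \<subseteq> K"
  using assms(1,2)
proof (induction p)
  case (Cons a p)
  then show ?case
    using assms(3) by (cases "p = []") (auto simp: walk_Cons)
qed (simp add: walk_def)

lemma component_self: "a \<in> verts G \<Longrightarrow> a \<in> component G a"
  by (auto simp: component_def walk_def intro!: exI[of _ "[a]"])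

lemma component_step:
  assumes "simple_graph G" "b \<in> component G a" "{b, c} \<in> edges G"
  shows "c \<in> component G a"
proof -
  obtain p where "walk G p" "hd p = a" "last p = b"
    using assms by (auto simp: component_def)
  then show ?thesis
    using walk_snoc[of G p c] simple_graph_edge_verts[OF assms(1,3)] assms(3)
    by (auto simp: component_def walk_def intro!: exI[of _ "p @ [c]"])
qed

lemma component_subset_closed:
  assumes "a \<in> K" "\<And>b c. {b, c} \<in> edges G \<Longrightarrow> b \<in> K \<Longrightarrow> c \<in> K"
  shows "component G a \<subseteq> K"
proof
  fix b assume "b \<in> component G a"
  then obtain p where p: "walk G p" "hd p = a" "last p = b"
    by (auto simp: component_def)
  moreover have "last p \<in> set p"
    using p by (auto simp: walk_def)
  ultimately show "b \<in> K"
    using walk_closed[of G p K] assms by blast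
qed

lemma component_subset_verts: "component G a \<subseteq> verts G"
  by (auto simp: component_def walk_def)

lemma components_disjoint:
  assumes "simple_graph G" "a \<in> verts G" "b \<in> verts G" "component G a \<noteq> component G b"
  shows "component G a \<inter> component G b = {}"
proof -
  have *: "component G d \<subseteq> component G c"
    if "c \<in> verts G" "d \<in> verts G" "component G c \<inter> component G d \<noteq> {}" for c d
  proof -
    have "d \<in> component G c"
    proof (rule ccontr)
      assume "d \<notin> component G c"
      \<comment> \<open>The complement of a component is closed under edges as well, so the
        component of \<open>d\<close> would never enter that of \<open>c\<close>.\<close>
      then have "component G d \<subseteq> - component G c"
        using component_step[OF assms(1), of _ c]
        by (intro component_subset_closed) (auto simp: insert_commute)
      then show False
        using that by auto
    qed
    then show ?thesis
      using component_step[OF assms(1)] by (intro component_subset_closed) auto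
  qed
  show ?thesis
    using *[of a b] *[of b a] assms by blast
qed

text \<open>A longest path in \<open>S\<close> cannot be extended at its first vertex, so a second
  edge at that vertex leads back to the path and closes a cycle.\<close>

lemma cycle_from_min_degree_two:
  assumes G: "simple_graph G" and S: "S \<noteq> {}" "S \<subseteq> verts G"
    and deg: "\<And>a. a \<in> S \<Longrightarrow> 2 \<le> card {f \<in> edges G. a \<in> f \<and> f \<subseteq> S}"
  shows "\<exists>p. cycle G p \<and> set p \<subseteq> S"
proof -
  define P where "P p \<longleftrightarrow> walk G p \<and> distinct p \<and> set p \<subseteq> S" for p
  have fin: "finite S"
    using G S finite_subset by (auto simp: simple_graph_def)
  obtain s where s: "s \<in> S"
    using S by auto
  then have "P [s]"
    using S by (auto simp: P_def walk_def)
  moreover have "\<forall>p. P p \<longrightarrow> length p \<le> card S"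
    using fin by (metis P_def card_mono distinct_card)
  ultimately obtain p where p: "P p" and max: "\<And>q. P q \<Longrightarrow> length q \<le> length p"
    using ex_has_greatest_nat[of P "[s]" length "Suc (card S)"] by (metis le_imp_less_Suc)
  obtain a q where aq: "p = a # q"
    using p by (cases p) (auto simp: P_def walk_def)
  have a: "a \<in> S"
    using p aq by (auto simp: P_def)
  \<comment> \<open>Only one edge at \<open>a\<close> continues along the path, so another one
    remains. If \<open>q\<close> is empty, \<open>hd q\<close> is unspecified, which is harmless:
    still at most one edge is excluded.\<close>
  have "\<not> {f \<in> edges G. a \<in> f \<and> f \<subseteq> S} \<subseteq> {{a, hd q}}"
  proof
    assume "{f \<in> edges G. a \<in> f \<and> f \<subseteq> S} \<subseteq> {{a, hd q}}"
    then have "card {f \<in> edges G. a \<in> f \<and> f \<subseteq> S} \<le> card {{a, hd q}}"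
      by (rule card_mono[rotated]) simp
    then show False
      using deg[OF a] by simp
  qed
  then obtain f where f: "f \<in> edges G" "a \<in> f" "f \<subseteq> S" "f \<noteq> {a, hd q}"
    by auto
  then obtain c where c: "f = {a, c}" "c \<noteq> a"
    using simple_graph_edgeE[OF G f(1)] by (metis doubleton_eq_iff insert_iff singletonD)
  have "c \<in> set p"
  proof (rule ccontr)
    assume "c \<notin> set p"
    then have "P (c # p)"
      using p c f S aq by (auto simp: P_def walk_Cons insert_commute)
    then show False
      using max by fastforce
  qed
  then obtain k where k: "k < length q" "q ! k = c"
    using c aq by (auto simp: in_set_conv_nth)
  have k0: "k \<noteq> 0"
    using k c f by (metis hd_conv_nth length_greater_0_conv)
  \<comment> \<open>The prefix of the path from \<open>a\<close> to \<open>c\<close>, of length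
    \<open>k + 2\<close>; it has at least three vertices because \<open>k\<close> is not 0.\<close>
  let ?r = "take (Suc (Suc k)) p"
  have "walk G ?r" "distinct ?r" "set ?r \<subseteq> S"
    using p walk_take set_take_subset[of "Suc (Suc k)" p] by (auto simp: P_def)
  moreover have "length ?r \<ge> 3"
    using aq k k0 by auto
  moreover have "last ?r = c" "hd ?r = a"
    using aq k by (auto simp: last_conv_nth take_Suc_conv_app_nth)
  ultimately have "cycle G ?r"
    using f c by (auto simp: cycle_def insert_commute)
  then show ?thesis
    using \<open>set ?r \<subseteq> S\<close> by blast
qed

text \<open>Induction on the size of \<open>S\<close>: removing a vertex that lies on at most one
  inner edge costs one vertex and at most one edge, so the inequality survives. If there is no such
  vertex, \<open>cycle_from_min_degree_two\<close> applies.\<close>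

lemma cycle_from_many_edges:
  assumes G: "simple_graph G" and S: "S \<noteq> {}" "S \<subseteq> verts G"
    and many: "card S \<le> card {f \<in> edges G. f \<subseteq> S}"
  shows "\<exists>p. cycle G p \<and> set p \<subseteq> S"
  using S many
proof (induction "card S" arbitrary: S rule: less_induct)
  case less
  have fin: "finite S"
    using G less.prems finite_subset by (auto simp: simple_graph_def)
  show ?case
  proof (cases "\<forall>a\<in>S. 2 \<le> card {f \<in> edges G. a \<in> f \<and> f \<subseteq> S}")
    case True
    then show ?thesis
      using cycle_from_min_degree_two[OF G less.prems(1,2)] by blast
  next
    case False
    then obtain a where a: "a \<in> S" "card {f \<in> edges G. a \<in> f \<and> f \<subseteq> S} \<le> 1"
      by force
    have "{f \<in> edges G. f \<subseteq> S} =
      {f \<in> edges G. a \<in> f \<and> f \<subseteq> S} \<union> {f \<in> edges G. f \<subseteq> S - {a}}"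
      by auto
    then have "card {f \<in> edges G. f \<subseteq> S} \<le>
      card {f \<in> edges G. a \<in> f \<and> f \<subseteq> S} + card {f \<in> edges G. f \<subseteq> S - {a}}"
      by (simp only: card_Un_le)
    then have le: "card (S - {a}) \<le> card {f \<in> edges G. f \<subseteq> S - {a}}"
      using a(2) less.prems(3) card_Diff_singleton[OF a(1)] by linarith
    have "S \<noteq> {a}"
    proof
      assume "S = {a}"
      have "{f \<in> edges G. f \<subseteq> S} = {}"
      proof (rule equals0I)
        fix f assume "f \<in> {f \<in> edges G. f \<subseteq> S}"
        then have "f \<in> edges G" "f \<subseteq> {a}"
          using \<open>S = {a}\<close> by auto
        then show False
          using simple_graph_edgeE[OF G, of f] by (metis insert_subset singletonD)
      qed
      then have "card S \<le> 0"
        using less.prems(3) by (simp only: card.empty)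
      then show False
        using \<open>S = {a}\<close> by simp
    qed
    then have "S - {a} \<noteq> {}" "S - {a} \<subseteq> verts G" "card (S - {a}) < card S"
      using a less.prems(2) card_Diff1_less[OF fin a(1)] by blast+
    then show ?thesis
      using less.hyps[of "S - {a}"] le by blast
  qed
qed

section \<open>Cyclic edge cuts as boundaries\<close>

lemma simple_graph_delete_edges: "simple_graph G \<Longrightarrow> simple_graph (delete_edges G C)"
  by (auto simp: simple_graph_def delete_edges_def)

lemma cubic_graph_handshake:
  assumes "cubic_graph G" "S \<subseteq> verts G"
  shows "3 * card S = 2 * card {f \<in> edges G. f \<subseteq> S} + card (boundary G S)"
  using handshake[of G S] assms by (simp add: cubic_graph_def subset_eq)

lemma cycle_card_ge_three:
  assumes "cycle G p" "set p \<subseteq> S" "finite S"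
  shows "3 \<le> card S"
  using assms by (metis card_mono cycle_def distinct_card le_trans)

text \<open>\<open>S\<close> is the component that contains one of the two cycles. Every edge of
  \<open>G\<close> leaving it must have been deleted, and the other cycle supplies three vertices
  outside.\<close>

lemma cyclic_edge_cut_imp_boundary:
  assumes G: "simple_graph G" and C: "cyclic_edge_cut G C"
  shows "\<exists>S \<subseteq> verts G. 3 \<le> card S \<and> 3 \<le> card (verts G - S) \<and> boundary G S \<subseteq> C"
proof -
  let ?H = "delete_edges G C"
  have H: "simple_graph ?H"
    using G by (rule simple_graph_delete_edges)
  have vH: "verts ?H = verts G"
    by (simp add: delete_edges_def)
  obtain a b p q where ab: "a \<in> verts G" "b \<in> verts G" "component ?H a \<noteq> component ?H b"
    and p: "cycle ?H p" "set p \<subseteq> component ?H a" and q: "cycle ?H q" "set q \<subseteq> component ?H b"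
    using C unfolding cyclic_edge_cut_def components_def vH by (elim conjE bexE exE imageE) blast
  let ?S = "component ?H a"
  have fin: "finite (verts G)"
    using G by (simp add: simple_graph_def)
  have S: "?S \<subseteq> verts G" "component ?H b \<subseteq> verts G"
    using component_subset_verts[of ?H] vH by auto
  have "set q \<subseteq> verts G - ?S"
    using components_disjoint[OF H] ab q S vH by blast
  then have "3 \<le> card (verts G - ?S)" "3 \<le> card ?S"
    using cycle_card_ge_three p q fin S finite_subset by (metis finite_Diff)+
  moreover have "boundary G ?S \<subseteq> C"
  proof
    fix f assume f: "f \<in> boundary G ?S"
    then obtain c d where cd: "f = {c, d}" "c \<in> ?S" "d \<notin> ?S"
      using simple_graph_edgeE[OF G, of f]
      by (auto simp: boundary_def) (metis crosses_doubleton insert_commute)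
    show "f \<in> C"
      using component_step[OF H, of c a d] cd f by (auto simp: boundary_def delete_edges_def)
  qed
  ultimately show ?thesis
    using S by blast
qed

lemma cubic_graph_small_cut_cycle:
  assumes G: "cubic_graph G" and S: "S \<subseteq> verts G" "3 \<le> card S" and d: "card (boundary G S) \<le> 4"
  shows "\<exists>p. cycle G p \<and> set p \<subseteq> S"
proof -
  have "3 * card S = 2 * card {f \<in> edges G. f \<subseteq> S} + card (boundary G S)"
    using cubic_graph_handshake[OF G S(1)] .
  \<comment> \<open>For three vertices this rests on parity: 9 = 2e + d makes d odd, so d is at most
    3 and e at least 3.\<close>
  then have "card S \<le> card {f \<in> edges G. f \<subseteq> S}"
    using S d by presburger
  then show ?thesis
    using cycle_from_many_edges[of G S] G S unfolding cubic_graph_def by force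
qed

lemma cycle_delete_boundary:
  assumes p: "cycle G p" "set p \<subseteq> S"
  shows "cycle (delete_edges G (boundary G S)) p"
proof -
  have "{p ! i, p ! Suc i} \<notin> boundary G S" if "Suc i < length p" for i
  proof -
    have "p ! i \<in> S" "p ! Suc i \<in> S"
      using that p by (auto intro!: subsetD[OF p(2)])
    then show ?thesis
      by (simp add: boundary_def)
  qed
  moreover have "last p \<in> S" "hd p \<in> S"
    using p by (auto simp: cycle_def walk_def intro!: subsetD[OF p(2)])
  ultimately show ?thesis
    using p by (auto simp: cycle_def walk_def delete_edges_def boundary_def)
qed

lemma walk_subset_component:
  assumes "walk G p"
  shows "set p \<subseteq> component G (hd p)"
proof
  fix a assume "a \<in> set p"
  then obtain i where i: "i < length p" "p ! i = a"
    by (auto simp: in_set_conv_nth)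
  then have "last (take (Suc i) p) = a" "hd (take (Suc i) p) = hd p"
    by (auto simp: take_Suc_conv_app_nth hd_append hd_conv_nth)
  then show "a \<in> component G (hd p)"
    using walk_take[OF assms, of i] by (auto simp: component_def)
qed

lemma delete_boundary_closed:
  assumes "{b, c} \<in> edges (delete_edges G (boundary G S))"
  shows "b \<in> S \<longleftrightarrow> c \<in> S"
  using assms by (auto simp: delete_edges_def boundary_def)

text \<open>Partial converse of \<open>cyclic_edge_cut_imp_boundary\<close>: counting puts a cycle
  on each side, and once the boundary is deleted no edge leaves \<open>S\<close>, so the two cycles
  lie in different components.\<close>

lemma small_boundary_cyclic_edge_cut:
  assumes G: "cubic_graph G" and S: "S \<subseteq> verts G" "3 \<le> card S" "3 \<le> card (verts G - S)"
    and d: "card (boundary G S) \<le> 4"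
  shows "cyclic_edge_cut G (boundary G S)"
proof -
  let ?H = "delete_edges G (boundary G S)"
  have sG: "simple_graph G"
    using G by (simp add: cubic_graph_def)
  obtain p where p: "cycle G p" "set p \<subseteq> S"
    using cubic_graph_small_cut_cycle[OF G S(1,2) d] by blast
  obtain q where q: "cycle G q" "set q \<subseteq> verts G - S"
    using cubic_graph_small_cut_cycle[OF G _ S(3)] d boundary_compl[OF sG, of S] by auto
  have pH: "cycle ?H p" and qH: "cycle ?H q"
    using cycle_delete_boundary[OF p] cycle_delete_boundary[OF q] boundary_compl[OF sG, of S] by auto
  have hd: "hd p \<in> S" "hd q \<in> verts G - S"
    using p q hd_in_set[of p] hd_in_set[of q] unfolding cycle_def walk_def by blast+
  have "component ?H (hd p) \<subseteq> S"
    using hd delete_boundary_closed[of _ _ G S] by (intro component_subset_closed) auto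
  moreover have "hd q \<in> component ?H (hd q)"
    using hd by (intro component_self) (auto simp: delete_edges_def)
  ultimately have "component ?H (hd p) \<noteq> component ?H (hd q)"
    using hd by auto
  moreover have "set p \<subseteq> component ?H (hd p)" "set q \<subseteq> component ?H (hd q)"
    using walk_subset_component pH qH by (auto simp: cycle_def)
  moreover have "hd p \<in> verts ?H" "hd q \<in> verts ?H"
    using hd S by (auto simp: delete_edges_def)
  moreover have "boundary G S \<subseteq> edges G"
    by (auto simp: boundary_def)
  ultimately show ?thesis
    using pH qH unfolding cyclic_edge_cut_def components_def by blast
qed

section \<open>Small cuts of a cyclically 4-connected cubic graph\<close>

lemma cubic_graph_card_boundary_compl:
  assumes "cubic_graph G"
  shows "card (boundary G (verts G - S)) = card (boundary G S)"
  using assms by (simp add: boundary_compl cubic_graph_def)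

text \<open>By the handshake identity, since one vertex spans no edge and two vertices span at most
  one.\<close>

lemma cubic_graph_boundary_small:
  assumes G: "cubic_graph G" and S: "S \<subseteq> verts G"
  shows "card S = 1 \<Longrightarrow> card (boundary G S) = 3" "card S = 2 \<Longrightarrow> 4 \<le> card (boundary G S)"
proof -
  have sG: "simple_graph G"
    using G by (simp add: cubic_graph_def)
  have eq: "3 * card S = 2 * card {f \<in> edges G. f \<subseteq> S} + card (boundary G S)"
    using cubic_graph_handshake[OF G S] .
  have f2: "f \<in> edges G \<Longrightarrow> card f = 2" for f
    using sG by (simp add: simple_graph_def)
  show "card (boundary G S) = 3" if "card S = 1"
  proof -
    have "finite S"
      using that card.infinite by fastforce
    have "{f \<in> edges G. f \<subseteq> S} = {}"
    proof (rule equals0I)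
      fix f assume "f \<in> {f \<in> edges G. f \<subseteq> S}"
      then show False
        using card_mono[OF \<open>finite S\<close>, of f] f2[of f] that by simp
    qed
    then have "card {f \<in> edges G. f \<subseteq> S} = 0"
      by (simp only: card.empty)
    then show ?thesis
      using eq that by linarith
  qed
  show "4 \<le> card (boundary G S)" if "card S = 2"
  proof -
    have "finite S"
      using that card.infinite by fastforce
    have "{f \<in> edges G. f \<subseteq> S} \<subseteq> {S}"
      using f2 that \<open>finite S\<close> by (auto dest: card_subset_eq)
    then have "card {f \<in> edges G. f \<subseteq> S} \<le> 1"
      using card_mono[of "{S}"] by simp
    then show ?thesis
      using eq that by linarith
  qed
qed

text \<open>A side with exactly two vertices is settled by counting. Otherwise both sides have at
  least three, and a smaller boundary would be a cyclic edge cut.\<close>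

lemma cyclically_4_connected_cut_ge_4:
  assumes G: "cyclically_connected 4 G" and S: "S \<subseteq> verts G" "2 \<le> card S" "2 \<le> card (verts G - S)"
  shows "4 \<le> card (boundary G S)"
proof -
  have cG: "cubic_graph G"
    using G by (simp add: cyclically_connected_def)
  consider "card S = 2" | "card (verts G - S) = 2" | "3 \<le> card S" "3 \<le> card (verts G - S)"
    using S by linarith
  then show ?thesis
  proof cases
    case 1
    then show ?thesis
      using cubic_graph_boundary_small(2)[OF cG S(1)] by simp
  next
    case 2
    then show ?thesis
      using cubic_graph_boundary_small(2)[OF cG Diff_subset, of S]
        cubic_graph_card_boundary_compl[OF cG, of S] by simp
  next
    case 3
    show ?thesis
    proof (rule ccontr)
      assume *: "\<not> 4 \<le> card (boundary G S)"
      then have "cyclic_edge_cut G (boundary G S)"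
        using small_boundary_cyclic_edge_cut[OF cG S(1) 3] by simp
      then show False
        using G * unfolding cyclically_connected_def by auto
    qed
  qed
qed

text \<open>So cyclic 4-connectivity entails 3-edge-connectivity: a single vertex has boundary 3,
  and larger sides fall under \<open>cyclically_4_connected_cut_ge_4\<close>.\<close>

lemma cyclically_4_connected_cut_ge_3:
  assumes G: "cyclically_connected 4 G" and S: "S \<subseteq> verts G" "S \<noteq> {}" "S \<noteq> verts G"
  shows "3 \<le> card (boundary G S)"
proof -
  have cG: "cubic_graph G"
    using G by (simp add: cyclically_connected_def)
  have fin: "finite (verts G)"
    using cG by (simp add: cubic_graph_def simple_graph_def)
  have "card S \<noteq> 0" "card (verts G - S) \<noteq> 0"
    using S fin finite_subset[OF S(1) fin] by auto
  then consider "card S = 1" | "card (verts G - S) = 1" | "2 \<le> card S" "2 \<le> card (verts G - S)"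
    by linarith
  then show ?thesis
  proof cases
    case 1
    then show ?thesis
      using cubic_graph_boundary_small(1)[OF cG S(1)] by simp
  next
    case 2
    then show ?thesis
      using cubic_graph_boundary_small(1)[OF cG Diff_subset, of S]
        cubic_graph_card_boundary_compl[OF cG, of S] by simp
  next
    case 3
    then show ?thesis
      using cyclically_4_connected_cut_ge_4[OF G S(1)] by simp
  qed
qed

text \<open>If \<open>S\<close> fell apart into \<open>K\<close> and \<open>S - K\<close>, their
  boundaries would be disjoint parts of the boundary of \<open>S\<close> with at least 3 edges each,
  hence 6 together.\<close>

lemma cyclically_4_connected_cut_sides_connected:
  assumes G: "cyclically_connected 4 G" and S: "S \<subseteq> verts G" "S \<noteq> verts G"
    and d: "card (boundary G S) \<le> 5" and ab: "a \<in> S" "b \<in> S"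
  shows "b \<in> component (delete_edges G (boundary G S)) a"
proof (rule ccontr)
  let ?H = "delete_edges G (boundary G S)"
  let ?K = "component ?H a"
  assume b: "b \<notin> ?K"
  have sG: "simple_graph G"
    using G by (simp add: cyclically_connected_def cubic_graph_def)
  have sH: "simple_graph ?H"
    using sG by (rule simple_graph_delete_edges)
  have K: "?K \<subseteq> S"
    using ab delete_boundary_closed[of _ _ G S] by (intro component_subset_closed) auto
  have a: "a \<in> ?K"
    using ab S by (intro component_self) (auto simp: delete_edges_def)
  have eq: "c \<in> ?K \<longleftrightarrow> d \<in> ?K" if "{c, d} \<in> edges G" "{c, d} \<notin> boundary G S" for c d
    using that component_step[OF sH, of c a d] component_step[OF sH, of d a c]
    by (auto simp: delete_edges_def insert_commute)
  \<comment> \<open>An edge between \<open>?K\<close> and \<open>S - ?K\<close> would survive the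
    deletion and extend the component, so an edge leaving either part leaves
    \<open>S\<close>.\<close>
  have edge: "crosses S f \<and> \<not> (crosses ?K f \<and> crosses (S - ?K) f)"
    if f: "f \<in> edges G" and cr: "crosses ?K f \<or> crosses (S - ?K) f" for f
  proof -
    obtain c d where cd: "f = {c, d}"
      using simple_graph_edgeE[OF sG f] by metis
    have "crosses S f"
      using eq[of c d] f cr cd by (auto simp: boundary_def)
    then show ?thesis
      using K cd by auto
  qed
  have "boundary G ?K \<union> boundary G (S - ?K) \<subseteq> boundary G S"
    "boundary G ?K \<inter> boundary G (S - ?K) = {}"
    using edge by (auto simp: boundary_def)
  then have "card (boundary G ?K) + card (boundary G (S - ?K)) \<le> card (boundary G S)"
    by (metis card_Un_disjoint card_mono finite_boundary sG)
  moreover have "3 \<le> card (boundary G ?K)"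
    using a b ab K S by (intro cyclically_4_connected_cut_ge_3[OF G]) auto
  moreover have "3 \<le> card (boundary G (S - ?K))"
    using a b ab K S by (intro cyclically_4_connected_cut_ge_3[OF G]) auto
  ultimately show False
    using d by linarith
qed

section \<open>Spanning connected 2-regular edge sets\<close>

text \<open>A hamiltonian cycle as an edge set: 2-regular, spanning, and connected, with
  connectedness phrased by cuts. Such a set can be restricted to a brick and carried back to
  \<open>G\<close>.\<close>

definition ham_edges :: "'a ugraph \<Rightarrow> 'a set set \<Rightarrow> bool" where
  "ham_edges G F \<longleftrightarrow> F \<subseteq> edges G \<and> (\<forall>a\<in>verts G. card {f \<in> F. a \<in> f} = 2) \<and>
     (\<forall>S\<subseteq>verts G. S \<noteq> {} \<longrightarrow> S \<noteq> verts G \<longrightarrow> (\<exists>f\<in>F. crosses S f))"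

definition cycle_edges :: "'a list \<Rightarrow> 'a set set" where
  "cycle_edges p = {{p ! i, p ! (Suc i mod length p)} | i. i < length p}"

lemma cycle_edges_subset:
  assumes "cycle G p"
  shows "cycle_edges p \<subseteq> edges G"
proof
  fix f assume "f \<in> cycle_edges p"
  then obtain i where i: "i < length p" "f = {p ! i, p ! (Suc i mod length p)}"
    by (auto simp: cycle_edges_def)
  show "f \<in> edges G"
  proof (cases "Suc i < length p")
    case True
    then show ?thesis
      using i assms by (auto simp: cycle_def walk_def)
  next
    case False
    then have "Suc i = length p"
      using i by simp
    then have "p ! i = last p" "p ! (Suc i mod length p) = hd p"
      using i by (metis diff_Suc_1 last_conv_nth length_0_conv less_nat_zero_code,
        metis hd_conv_nth length_0_conv less_nat_zero_code mod_self)
    then show ?thesis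
      using i assms by (simp add: cycle_def)
  qed
qed

lemma card_cycle_edges_at:
  assumes p: "cycle G p" and a: "a \<in> set p"
  shows "card {f \<in> cycle_edges p. a \<in> f} = 2"
proof -
  let ?n = "length p"
  have dist: "distinct p" and n: "?n \<ge> 3"
    using p by (auto simp: cycle_def)
  obtain i where i: "i < ?n" "p ! i = a"
    using a by (auto simp: in_set_conv_nth)
  \<comment> \<open>\<open>j\<close> and \<open>k\<close> are the positions cyclically before and
    after \<open>i\<close>; length at least 3 makes the three positions distinct.\<close>
  define j where "j = (if i = 0 then ?n - 1 else i - 1)"
  define k where "k = (if Suc i = ?n then 0 else Suc i)"
  have jk: "j < ?n" "k < ?n" "j \<noteq> k" "j \<noteq> i" "k \<noteq> i"
    using i n by (auto simp: j_def k_def)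
  have mod: "Suc l mod ?n = (if Suc l = ?n then 0 else Suc l)" if "l < ?n" for l
    using that by auto
  have eqi: "(Suc l mod ?n = i) \<longleftrightarrow> l = j" if "l < ?n" for l
    unfolding mod[OF that] using that i n by (auto simp: j_def split: if_splits)
  have ki: "Suc i mod ?n = k"
    unfolding mod[OF i(1)] by (simp add: k_def)
  have ji: "Suc j mod ?n = i"
    using eqi[OF jk(1)] by simp
  have "{f \<in> cycle_edges p. a \<in> f} = {{p ! i, p ! k}, {p ! j, p ! i}}"
  proof (intro equalityI subsetI)
    fix f assume "f \<in> {f \<in> cycle_edges p. a \<in> f}"
    then obtain l where l: "l < ?n" "f = {p ! l, p ! (Suc l mod ?n)}" "p ! i \<in> f"
      using i by (auto simp: cycle_edges_def)
    have "Suc l mod ?n < ?n"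
      using n by (intro mod_less_divisor) linarith
    then have "l = i \<or> Suc l mod ?n = i"
      using l i dist by (auto simp: nth_eq_iff_index_eq)
    then show "f \<in> {{p ! i, p ! k}, {p ! j, p ! i}}"
      using l eqi[OF l(1)] ki by auto
  next
    fix f assume "f \<in> {{p ! i, p ! k}, {p ! j, p ! i}}"
    then show "f \<in> {f \<in> cycle_edges p. a \<in> f}"
      using i jk ki ji unfolding cycle_edges_def by auto
  qed
  moreover have "p ! j \<noteq> p ! k" "p ! j \<noteq> p ! i" "p ! k \<noteq> p ! i"
    using dist jk i by (auto simp: nth_eq_iff_index_eq)
  ultimately show ?thesis
    by (simp add: doubleton_eq_iff)
qed

lemma hamiltonian_imp_ham_edges:
  assumes "hamiltonian G"
  shows "\<exists>F. ham_edges G F"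
proof -
  obtain p where p: "cycle G p" "set p = verts G"
    using assms by (auto simp: hamiltonian_def)
  have n: "length p \<ge> 3"
    using p by (simp add: cycle_def)
  have "\<exists>f\<in>cycle_edges p. crosses S f" if S: "S \<subseteq> verts G" "S \<noteq> {}" "S \<noteq> verts G" for S
  proof (rule ccontr)
    assume "\<not> ?thesis"
    \<comment> \<open>Without a crossing edge, membership in \<open>S\<close> is passed on from each
      vertex of the cycle to the next, so all vertices agree with \<open>p ! 0\<close>.\<close>
    then have step: "p ! i \<in> S \<longleftrightarrow> p ! (Suc i mod length p) \<in> S" if "i < length p" for i
      using that unfolding cycle_edges_def by (metis (mono_tags, lifting) crosses_doubleton mem_Collect_eq)
    have all: "i < length p \<Longrightarrow> p ! i \<in> S \<longleftrightarrow> p ! 0 \<in> S" for i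
    proof (induction i)
      case (Suc i)
      then show ?case
        using step[of i] by simp
    qed simp
    have "a \<in> S \<longleftrightarrow> p ! 0 \<in> S" if "a \<in> verts G" for a
      using all that unfolding p(2)[symmetric] in_set_conv_nth by auto
    then show False
      using S by blast
  qed
  then have "ham_edges G (cycle_edges p)"
    using p cycle_edges_subset[OF p(1)] card_cycle_edges_at[OF p(1)] by (simp add: ham_edges_def)
  then show ?thesis ..
qed

text \<open>Degree 2 yields some cycle in \<open>F\<close>. It uses up both \<open>F\<close>-edges
  at each of its vertices, so no edge of \<open>F\<close> leaves it, and the cut condition makes it
  spanning.\<close>

lemma ham_edges_imp_hamiltonian:
  assumes G: "simple_graph G" and F: "ham_edges G F" and ne: "verts G \<noteq> {}"
  shows "hamiltonian G"
proof -
  let ?H = "\<lparr>verts = verts G, edges = F\<rparr>"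
  have FE: "F \<subseteq> edges G"
    using F by (simp add: ham_edges_def)
  have sH: "simple_graph ?H"
    using G FE by (auto simp: simple_graph_def)
  have finF: "finite F"
    using simple_graph_finite_edges[OF sH] by simp
  have deg: "card {f \<in> F. a \<in> f} = 2" if "a \<in> verts G" for a
    using F that by (simp add: ham_edges_def)
  have "2 \<le> card {f \<in> edges ?H. a \<in> f \<and> f \<subseteq> verts G}" if "a \<in> verts G" for a
  proof -
    have "{f \<in> edges ?H. a \<in> f \<and> f \<subseteq> verts G} = {f \<in> F. a \<in> f}"
      using sH by (auto simp: simple_graph_def)
    then show ?thesis
      using deg[OF that] by simp
  qed
  then obtain p where p: "cycle ?H p"
    using cycle_from_min_degree_two[OF sH, of "verts G"] ne by auto
  have pG: "cycle G p"
    using p FE by (auto simp: cycle_def walk_def)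
  have sub: "set p \<subseteq> verts G" "p \<noteq> []"
    using pG by (auto simp: cycle_def walk_def)
  have "\<not> crosses (set p) f" if f: "f \<in> F" for f
  proof
    assume cr: "crosses (set p) f"
    then obtain a where a: "a \<in> set p" "a \<in> f"
      by (auto simp: crosses_def)
    have "{f \<in> cycle_edges p. a \<in> f} \<subseteq> {f \<in> F. a \<in> f}"
      using cycle_edges_subset[OF p] by auto
    then have "{f \<in> cycle_edges p. a \<in> f} = {f \<in> F. a \<in> f}"
      using card_cycle_edges_at[OF p a(1)] deg[of a] a sub finF by (intro card_subset_eq) auto
    then have "f \<in> cycle_edges p"
      using f a by auto
    then have "f \<subseteq> set p"
      using sub by (auto simp: cycle_edges_def)
    then show False
      using cr by (simp add: crosses_def)
  qed
  then have "set p = verts G"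
    using F sub unfolding ham_edges_def by (metis set_empty)
  then show ?thesis
    using pG by (auto simp: hamiltonian_def)
qed

text \<open>The handshake identity in the graph with edge set \<open>F\<close>, where the degree sum
  over \<open>S\<close> is twice the size of \<open>S\<close>.\<close>

lemma ham_edges_even_boundary:
  assumes G: "simple_graph G" and F: "ham_edges G F" and S: "S \<subseteq> verts G"
  shows "even (card {f \<in> F. crosses S f})"
proof -
  let ?H = "\<lparr>verts = verts G, edges = F\<rparr>"
  have "simple_graph ?H"
    using G F by (auto simp: simple_graph_def ham_edges_def)
  from handshake[OF this, of S]
  have "(\<Sum>a\<in>S. card {f \<in> F. a \<in> f}) = 2 * card {f \<in> F. f \<subseteq> S} + card {f \<in> F. crosses S f}"
    using S by (simp add: boundary_def)
  moreover have "(\<Sum>a\<in>S. card {f \<in> F. a \<in> f}) = (\<Sum>a\<in>S. 2)"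
    using F S by (intro sum.cong) (auto simp: ham_edges_def)
  ultimately show ?thesis
    by simp presburger
qed

section \<open>The edges of the construction\<close>

text \<open>Bundling the two indices of a brick into one pair lets sums over all bricks range over a
  single set on which \<open>partner\<close> acts.\<close>

definition bcopy :: "'u \<times> nat \<Rightarrow> 'a \<Rightarrow> ('a, 'u) tvertex" where
  "bcopy p a = Copy (fst p) (snd p) a"

lemma bcopy_eq_iff [simp]: "bcopy p a = bcopy q b \<longleftrightarrow> p = q \<and> a = b"
  by (auto simp: bcopy_def prod_eq_iff)

lemma bcopy_neq_Hub [simp]: "bcopy p a \<noteq> Hub u j" "Hub u j \<noteq> bcopy p a"
  by (auto simp: bcopy_def)

lemma bcopy_in_image_iff [simp]: "bcopy p a \<in> bcopy q ` f \<longleftrightarrow> p = q \<and> a \<in> f"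
  by auto

lemma inj_bcopy: "inj (bcopy p)"
  by (auto simp: inj_def)

text \<open>The numeric core of sparseness for a set without hubs; \<open>b\<close>,
  \<open>d\<close> and \<open>n\<close> stand for the cost, the deviation and the size in each
  brick. Three vertices either lie in one brick, with \<open>b + d\<close> at least 5, or occupy two
  bricks, with \<open>b + d\<close> at least 3 each.\<close>

lemma three_bricks_no_hub_arith:
  fixes d1 d2 d3 b1 b2 b3 n1 n2 n3 :: nat
  assumes "d1 \<le> b1" "n1 = 0 \<or> 2 \<le> b1" "n1 = 0 \<or> 3 \<le> b1 + d1" "n1 \<le> 1 \<or> 3 \<le> b1" "n1 \<le> 2 \<or> 5 \<le> b1 + d1"
    and "d2 \<le> b2" "n2 = 0 \<or> 2 \<le> b2" "n2 = 0 \<or> 3 \<le> b2 + d2" "n2 \<le> 1 \<or> 3 \<le> b2" "n2 \<le> 2 \<or> 5 \<le> b2 + d2"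
    and "d3 \<le> b3" "n3 = 0 \<or> 2 \<le> b3" "n3 = 0 \<or> 3 \<le> b3 + d3" "n3 \<le> 1 \<or> 3 \<le> b3" "n3 \<le> 2 \<or> 5 \<le> b3 + d3"
  shows "d1 + d2 + d3 \<le> b1 + b2 + b3 \<and>
    (1 \<le> n1 + n2 + n3 \<longrightarrow> 2 \<le> b1 + b2 + b3) \<and> (2 \<le> n1 + n2 + n3 \<longrightarrow> 3 \<le> b1 + b2 + b3) \<and>
    (3 \<le> n1 + n2 + n3 \<longrightarrow> 5 \<le> b1 + b2 + b3 + (d1 + d2 + d3))"
proof (intro conjI impI)
  show "d1 + d2 + d3 \<le> b1 + b2 + b3"
    using assms(1,6,11) by linarith
  show "2 \<le> b1 + b2 + b3" if "1 \<le> n1 + n2 + n3"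
    using that assms(2,7,12) by (elim disjE) linarith+
  show "3 \<le> b1 + b2 + b3" if "2 \<le> n1 + n2 + n3"
    using that assms(2,4,7,9,12,14) by (elim disjE) linarith+
  show "5 \<le> b1 + b2 + b3 + (d1 + d2 + d3)" if "3 \<le> n1 + n2 + n3"
    using that assms(3,5,8,10,13,15) by (elim disjE) linarith+
qed

text \<open>The counterpart for a set with one hub, which adds 1 to the size and at least 1 to the
  cost of every brick. Two further vertices raise the total of 3 to 5: in one brick as 3 + 1 + 1, in
  two bricks as 2 + 2 + 1.\<close>

lemma three_bricks_one_hub_arith:
  fixes d1 d2 d3 b1 b2 b3 n1 n2 n3 :: nat
  assumes "d1 \<le> b1" "1 \<le> b1" "n1 = 0 \<or> 2 \<le> b1" "n1 \<le> 1 \<or> 3 \<le> b1 + d1"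
    and "d2 \<le> b2" "1 \<le> b2" "n2 = 0 \<or> 2 \<le> b2" "n2 \<le> 1 \<or> 3 \<le> b2 + d2"
    and "d3 \<le> b3" "1 \<le> b3" "n3 = 0 \<or> 2 \<le> b3" "n3 \<le> 1 \<or> 3 \<le> b3 + d3"
  shows "d1 + d2 + d3 \<le> b1 + b2 + b3 \<and>
    (1 \<le> n1 + n2 + n3 + 1 \<longrightarrow> 2 \<le> b1 + b2 + b3) \<and> (2 \<le> n1 + n2 + n3 + 1 \<longrightarrow> 3 \<le> b1 + b2 + b3) \<and>
    (3 \<le> n1 + n2 + n3 + 1 \<longrightarrow> 5 \<le> b1 + b2 + b3 + (d1 + d2 + d3))"
proof (intro conjI impI)
  show "d1 + d2 + d3 \<le> b1 + b2 + b3"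
    using assms(1,5,9) by linarith
  show "2 \<le> b1 + b2 + b3" if "1 \<le> n1 + n2 + n3 + 1"
    using that assms(2,6,10) by linarith
  show "3 \<le> b1 + b2 + b3" if "2 \<le> n1 + n2 + n3 + 1"
    using that assms(2,6,10) by linarith
  show "5 \<le> b1 + b2 + b3 + (d1 + d2 + d3)" if "3 \<le> n1 + n2 + n3 + 1"
    using that assms(2,3,4,6,7,8,10,11,12) by (elim disjE) linarith+
qed

text \<open>The distance bounds appear as \<open>far\<close>: \<open>x\<close> and \<open>y\<close>
  differ from \<open>v\<close> and are not adjacent to it. Non-hamiltonicity of \<open>G\<close> is
  a premise of the lemmas on hamiltonian cycles instead.\<close>

locale triple_construction =
  fixes G :: "'a ugraph" and v x y :: 'a and w :: "nat \<Rightarrow> 'a"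
    and M :: "('u, 'f) mgraph" and \<sigma> :: "'u \<Rightarrow> nat \<Rightarrow> 'f"
  assumes cyc4: "cyclically_connected 4 G"
    and v: "v \<in> verts G"
    and w: "bij_betw w {1, 2, 3} (neighbours G v)"
    and xy: "{x, y} \<in> edges G"
    and far: "x \<noteq> v" "y \<noteq> v" "{v, x} \<notin> edges G" "{v, y} \<notin> edges G"
    and cut4: "\<And>C. cyclic_edge_cut G C \<Longrightarrow> card C = 4 \<Longrightarrow>
           (\<forall>c\<in>C. x \<notin> c) \<and> component (delete_edges G C) v \<noteq> component (delete_edges G C) x"
    and M: "cubic_multigraph M" "edge_connected 3 M"
    and \<sigma>: "brick_assignment M \<sigma>"
begin

section \<open>The index set of a triple and the edges of \<open>G\<close>\<close>

definition I :: "nat set" where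
  "I = {1, 2, 3}"

text \<open>A pair \<open>(u, i) \<in> P\<close> stands for the brick \<open>B\<^sub>i\<close> of the triple at \<open>u\<close>.\<close>

definition P :: "('u \<times> nat) set" where
  "P = mverts M \<times> I"

abbreviation "T \<equiv> triple_graph G v w x y M \<sigma>"
abbreviation "brick_edges \<equiv> edges (brick G v {x, y})"

lemma finite_I [simp]: "finite I" and card_I [simp]: "card I = 3"
  by (auto simp: I_def)

lemma sum_I: "sum g I = g 1 + g 2 + g 3"
  for g :: "nat \<Rightarrow> nat"
  by (simp add: I_def)

lemma in_P_iff: "p \<in> P \<longleftrightarrow> fst p \<in> mverts M \<and> snd p \<in> I"
  by (auto simp: P_def mem_Times_iff)

lemma sum_P: "sum g P = (\<Sum>u\<in>mverts M. \<Sum>i\<in>I. g (u, i))"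
  for g :: "'u \<times> nat \<Rightarrow> nat"
  unfolding P_def by (simp add: sum.cartesian_product)

lemma w_bij: "bij_betw w I (neighbours G v)"
  using w by (simp add: I_def)

lemma cG: "cubic_graph G" and sG: "simple_graph G"
  using cyc4 by (auto simp: cyclically_connected_def cubic_graph_def)

lemma finite_V: "finite (verts G)" and finite_E: "finite (edges G)"
  using sG simple_graph_finite_edges by (auto simp: simple_graph_def)

lemma x_neq_y: "x \<noteq> y" and xy_verts: "x \<in> verts G" "y \<in> verts G"
  using simple_graph_edge_verts[OF sG xy] by auto

lemma vw_edge: "j \<in> I \<Longrightarrow> {v, w j} \<in> edges G"
  using bij_betwE[OF w_bij] by (auto simp: neighbours_def)

lemma w_verts: "j \<in> I \<Longrightarrow> w j \<in> verts G" and w_neq_v: "j \<in> I \<Longrightarrow> w j \<noteq> v"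
  using simple_graph_edge_verts[OF sG vw_edge] by auto

lemma w_inj: "j \<in> I \<Longrightarrow> k \<in> I \<Longrightarrow> w j = w k \<longleftrightarrow> j = k"
  using w_bij by (auto simp: bij_betw_def inj_on_def)

lemma brick_edge:
  assumes "f \<in> brick_edges"
  shows "f \<in> edges G" "v \<notin> f" "f \<noteq> {x, y}" "f \<subseteq> verts G - {v}" "f \<noteq> {}" "card f = 2"
  using assms sG by (auto simp: brick_def simple_graph_def)

lemma finite_brick_edges: "finite brick_edges"
  by (rule finite_subset[OF _ finite_E]) (auto simp: brick_def)

lemma edges_G: "edges G = (brick_edges \<union> (\<lambda>j. {v, w j}) ` I) \<union> {{x, y}}"
proof (intro equalityI subsetI)
  fix f assume f: "f \<in> edges G"
  show "f \<in> (brick_edges \<union> (\<lambda>j. {v, w j}) ` I) \<union> {{x, y}}"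
  proof (cases "v \<in> f")
    case True
    then obtain b where b: "f = {v, b}"
      using simple_graph_edgeE[OF sG f] by (metis doubleton_eq_iff insert_iff singletonD)
    then have "b \<in> w ` I"
      using f w_bij by (auto simp: neighbours_def bij_betw_def)
    then show ?thesis
      using b by blast
  next
    case False
    then show ?thesis
      using f by (auto simp: brick_def)
  qed
next
  fix f assume "f \<in> (brick_edges \<union> (\<lambda>j. {v, w j}) ` I) \<union> {{x, y}}"
  then show "f \<in> edges G"
    using xy vw_edge brick_edge(1) by blast
qed

text \<open>The three summands correspond to the brick, hub and linking edges in
  \<open>sum_edges_T\<close>, so weights on \<open>G\<close> and on the construction can be compared
  term by term.\<close>

lemma sum_edges_G:
  fixes g :: "'a set \<Rightarrow> nat"
  shows "sum g (edges G) = (\<Sum>f\<in>brick_edges. g f) + (\<Sum>j\<in>I. g {v, w j}) + g {x, y}"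
proof -
  have inj: "inj_on (\<lambda>j. {v, w j}) I"
    by (rule inj_onI) (metis doubleton_eq_iff w_inj)
  have "sum g (edges G) = sum g (brick_edges \<union> (\<lambda>j. {v, w j}) ` I) + sum g {{x, y}}"
    unfolding edges_G using finite_brick_edges brick_edge(3) far
    by (intro sum.union_disjoint) (auto simp: doubleton_eq_iff)
  also have "sum g (brick_edges \<union> (\<lambda>j. {v, w j}) ` I) = sum g brick_edges + sum g ((\<lambda>j. {v, w j}) ` I)"
    using finite_brick_edges brick_edge(2) by (intro sum.union_disjoint) auto
  also have "sum g ((\<lambda>j. {v, w j}) ` I) = (\<Sum>j\<in>I. g {v, w j})"
    using inj by (rule sum.reindex_cong) auto
  finally show ?thesis
    by simp
qed

lemma finite_mverts: "finite (mverts M)" and finite_P: "finite P"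
  using M(1) by (auto simp: cubic_multigraph_def multigraph_def P_def)

lemma assign_bij: "u \<in> mverts M \<Longrightarrow> bij_betw (\<sigma> u) I (incident_edges M u)"
  using \<sigma> by (simp add: brick_assignment_def I_def)

text \<open>The assignment provides three different edges at \<open>u\<close>. They already exhaust
  the degree 3, in which a loop would be counted once more.\<close>

lemma no_loops:
  assumes "f \<in> medges M" "u \<in> mverts M"
  shows "ends M f \<noteq> {u}"
proof -
  have "card (incident_edges M u) = card I"
    using bij_betw_same_card[OF assign_bij[OF assms(2)]] by simp
  then have "card {f \<in> medges M. ends M f = {u}} = 0"
    using M(1) assms(2) by (auto simp: cubic_multigraph_def mdegree_def)
  moreover have "finite {f \<in> medges M. ends M f = {u}}"
    using M(1) by (simp add: cubic_multigraph_def multigraph_def)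
  ultimately show ?thesis
    using assms(1) by auto
qed

section \<open>Partner bricks: the two bricks assigned to one edge of \<open>M\<close>\<close>

definition edge_of :: "'u \<times> nat \<Rightarrow> 'f" where
  "edge_of p = \<sigma> (fst p) (snd p)"

definition is_partner :: "'u \<times> nat \<Rightarrow> 'u \<times> nat \<Rightarrow> bool" where
  "is_partner p q \<longleftrightarrow> p \<in> P \<and> q \<in> P \<and> fst q \<noteq> fst p \<and> edge_of q = edge_of p"

definition partner :: "'u \<times> nat \<Rightarrow> 'u \<times> nat" where
  "partner p = (THE q. is_partner p q)"

lemma edge_of_incident: "p \<in> P \<Longrightarrow> edge_of p \<in> medges M \<and> fst p \<in> ends M (edge_of p)"
  using bij_betwE[OF assign_bij, of "fst p"] by (auto simp: edge_of_def incident_edges_def in_P_iff)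

lemma ends_is_partner:
  assumes "is_partner p q"
  shows "ends M (edge_of p) = {fst p, fst q}"
proof -
  have "edge_of p \<in> medges M" "{fst p, fst q} \<subseteq> ends M (edge_of p)" "fst p \<noteq> fst q"
    using assms edge_of_incident[of p] edge_of_incident[of q] by (auto simp: is_partner_def)
  moreover from this have "card (ends M (edge_of p)) \<le> 2" "finite (ends M (edge_of p))"
    using M(1) card.infinite by (fastforce simp: cubic_multigraph_def multigraph_def)+
  ultimately show ?thesis
    by (metis card_2_iff card_seteq)
qed

text \<open>Without loops the edge has exactly one other end, and the assignment at that end is a
  bijection, so exactly one brick there belongs to the edge.\<close>

lemma ex1_partner:
  assumes p: "p \<in> P"
  shows "\<exists>!q. is_partner p q"
proof -
  let ?f = "edge_of p"
  have f: "?f \<in> medges M" "fst p \<in> ends M ?f"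
    using edge_of_incident[OF p] by auto
  have ends: "ends M ?f \<subseteq> mverts M" "card (ends M ?f) = 1 \<or> card (ends M ?f) = 2"
    using f M(1) by (auto simp: cubic_multigraph_def multigraph_def)
  have "ends M ?f \<noteq> {fst p}"
    using no_loops f p by (auto simp: in_P_iff)
  then have "card (ends M ?f) = 2"
    using ends f by (metis card_1_singletonE singletonD)
  then obtain u' where u': "ends M ?f = {fst p, u'}" "u' \<noteq> fst p"
    using f by (metis card_2_iff doubleton_eq_iff insert_iff singletonD)
  have "u' \<in> mverts M"
    using ends u' by auto
  then have bij: "bij_betw (\<sigma> u') I (incident_edges M u')"
    by (rule assign_bij)
  moreover have "?f \<in> incident_edges M u'"
    using f u' by (simp add: incident_edges_def)
  ultimately have "?f \<in> \<sigma> u' ` I"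
    by (simp add: bij_betw_def)
  then obtain i where i: "i \<in> I" "\<sigma> u' i = ?f"
    by (metis imageE)
  show ?thesis
  proof (rule ex1I[of _ "(u', i)"])
    show "is_partner p (u', i)"
      using p \<open>u' \<in> mverts M\<close> i u' unfolding is_partner_def edge_of_def in_P_iff by simp
    fix q assume q: "is_partner p q"
    then have "fst q = u'"
      using ends_is_partner[OF q] u' by (metis doubleton_eq_iff)
    moreover have "snd q = i"
    proof -
      have "snd q \<in> I" "\<sigma> u' (snd q) = \<sigma> u' i"
        using q i \<open>fst q = u'\<close> by (auto simp: is_partner_def edge_of_def in_P_iff)
      then show ?thesis
        using bij i unfolding bij_betw_def inj_on_def by blast
    qed
    ultimately show "q = (u', i)"
      by (simp add: prod_eq_iff)
  qed
qed

lemma is_partner_partner: "p \<in> P \<Longrightarrow> is_partner p (partner p)"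
  unfolding partner_def by (rule theI') (rule ex1_partner)

lemma partner_eqI: "is_partner p q \<Longrightarrow> partner p = q"
  using ex1_partner is_partner_partner unfolding is_partner_def by blast

lemma partner_in_P: "p \<in> P \<Longrightarrow> partner p \<in> P"
  and fst_partner: "p \<in> P \<Longrightarrow> fst (partner p) \<noteq> fst p"
  using is_partner_partner by (auto simp: is_partner_def)

lemma partner_partner: "p \<in> P \<Longrightarrow> partner (partner p) = p"
  using is_partner_partner[of p] by (intro partner_eqI) (auto simp: is_partner_def)

lemma partner_neq: "p \<in> P \<Longrightarrow> partner p \<noteq> p"
  using fst_partner by metis

lemma partner_eq_iff: "p \<in> P \<Longrightarrow> q \<in> P \<Longrightarrow> partner p = q \<longleftrightarrow> p = partner q"
  using partner_partner by metis

lemma bij_partner: "bij_betw partner P P"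
  by (rule bij_betw_byWitness[where f' = partner]) (auto simp: partner_partner partner_in_P)

section \<open>Vertices, edges and weighted edge sums of the construction\<close>

definition hub_edge :: "'u \<times> nat \<Rightarrow> nat \<Rightarrow> ('a, 'u) tvertex set" where
  "hub_edge p j = {Hub (fst p) j, bcopy p (w j)}"

text \<open>Indexed by the brick that contributes the vertex \<open>x\<close>. The other linking
  edge between the same two bricks is \<open>link (partner p)\<close>, so each linking edge belongs
  to exactly one index.\<close>

definition link :: "'u \<times> nat \<Rightarrow> ('a, 'u) tvertex set" where
  "link p = {bcopy p x, bcopy (partner p) y}"

lemma verts_T: "verts T = (\<lambda>(p, a). bcopy p a) ` (P \<times> (verts G - {v})) \<union> case_prod Hub ` P"
  unfolding triple_graph_def ugraph.simps by (fastforce simp: brick_def bcopy_def image_iff P_def I_def)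

lemma bcopy_in_verts: "bcopy p a \<in> verts T \<longleftrightarrow> p \<in> P \<and> a \<in> verts G - {v}"
  by (auto simp: verts_T)

lemma Hub_in_verts: "Hub u j \<in> verts T \<longleftrightarrow> u \<in> mverts M \<and> j \<in> I"
  by (auto simp: verts_T P_def)

lemma verts_T_cases:
  assumes "a \<in> verts T"
  obtains q c where "q \<in> P" "c \<in> verts G - {v}" "a = bcopy q c"
    | u j where "u \<in> mverts M" "j \<in> I" "a = Hub u j"
  using assms unfolding verts_T
proof (elim UnE imageE)
  fix z assume "a = (\<lambda>(p, a). bcopy p a) z" "z \<in> P \<times> (verts G - {v})"
  then show thesis
    using that(1)[of "fst z" "snd z"] by (simp add: split_def mem_Times_iff)
next
  fix z assume "a = case_prod Hub z" "z \<in> P"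
  then show thesis
    using that(2)[of "fst z" "snd z"] by (simp add: split_def in_P_iff)
qed

lemma edges_T: "edges T = ((\<lambda>(p, f). bcopy p ` f) ` (P \<times> brick_edges) \<union> 
    (\<lambda>(p, j). hub_edge p j) ` (P \<times> I)) \<union> link ` P"
proof -
  have 1: "{Copy u i ` f | u i f. u \<in> mverts M \<and> i \<in> I \<and> f \<in> brick_edges} =
    (\<lambda>(p, f). bcopy p ` f) ` (P \<times> brick_edges)"
    by (fastforce simp: bcopy_def image_iff in_P_iff)
  have 2: "{{Hub u j, Copy u i (w j)} | u i j. u \<in> mverts M \<and> i \<in> I \<and> j \<in> I} =
    (\<lambda>(p, j). hub_edge p j) ` (P \<times> I)"
    unfolding hub_edge_def bcopy_def by (fastforce simp: in_P_iff)
  have 3: "{{Copy u i x, Copy u' i' y} | u u' i i' f.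
          f \<in> medges M \<and> ends M f = {u, u'} \<and> u \<noteq> u' \<and>
          i \<in> I \<and> i' \<in> I \<and> \<sigma> u i = f \<and> \<sigma> u' i' = f} = link ` P" (is "?L = _")
  proof (intro equalityI subsetI)
    fix e assume "e \<in> ?L"
    then obtain u u' i i' f where e: "e = {Copy u i x, Copy u' i' y}"
      and f: "f \<in> medges M" "ends M f = {u, u'}" "u \<noteq> u'" "i \<in> I" "i' \<in> I" "\<sigma> u i = f" "\<sigma> u' i' = f"
      by blast
    have "u \<in> mverts M" "u' \<in> mverts M"
      using f M(1) by (auto simp: cubic_multigraph_def multigraph_def)
    then have "(u, i) \<in> P" "partner (u, i) = (u', i')"
      using f by (auto intro!: partner_eqI simp: is_partner_def edge_of_def in_P_iff)
    then show "e \<in> link ` P"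
      using e by (intro image_eqI[of _ _ "(u, i)"]) (auto simp: link_def bcopy_def)
  next
    fix e assume "e \<in> link ` P"
    then obtain p where p: "p \<in> P" "e = link p"
      by blast
    have q: "is_partner p (partner p)"
      using p by (intro is_partner_partner)
    have "e = {Copy (fst p) (snd p) x, Copy (fst (partner p)) (snd (partner p)) y}"
      "edge_of p \<in> medges M" "ends M (edge_of p) = {fst p, fst (partner p)}" "fst p \<noteq> fst (partner p)"
      "snd p \<in> I" "snd (partner p) \<in> I" "\<sigma> (fst p) (snd p) = edge_of p"
      "\<sigma> (fst (partner p)) (snd (partner p)) = edge_of p"
      using p q ends_is_partner[OF q] edge_of_incident[of p]
      by (auto simp: is_partner_def link_def bcopy_def edge_of_def in_P_iff)
    then show "e \<in> ?L"
      by blast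
  qed
  show ?thesis
    unfolding triple_graph_def ugraph.simps 1[unfolded I_def] 2[unfolded I_def] 3[unfolded I_def] I_def ..
qed

text \<open>The three parametrisations are injective, for \<open>link\<close> because
  \<open>x\<close> and \<open>y\<close> differ. Their ranges are disjoint: only hub edges contain a
  hub, and only linking edges meet two bricks. Degrees and cuts are obtained by choosing the weight
  \<open>g\<close>.\<close>

lemma sum_edges_T:
  fixes g :: "('a, 'u) tvertex set \<Rightarrow> nat"
  shows "sum g (edges T) =
    (\<Sum>p\<in>P. (\<Sum>f\<in>brick_edges. g (bcopy p ` f)) + (\<Sum>j\<in>I. g (hub_edge p j)) + g (link p))"
proof -
  let ?A = "(\<lambda>(p, f). bcopy p ` f) ` (P \<times> brick_edges)"
  let ?B = "(\<lambda>(p, j). hub_edge p j) ` (P \<times> I)"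
  have injA: "inj_on (\<lambda>(p, f). bcopy p ` f) (P \<times> brick_edges)"
  proof (rule inj_onI)
    fix c d assume c: "c \<in> P \<times> brick_edges"
      and eq': "(\<lambda>(p, f). bcopy p ` f) c = (\<lambda>(p, f). bcopy p ` f) d"
    obtain p f q g where cd: "c = (p, f)" "d = (q, g)"
      by (metis surj_pair)
    have eq: "bcopy p ` f = bcopy q ` g" and f: "f \<in> brick_edges"
      using c eq' cd by auto
    obtain a where "a \<in> f"
      using brick_edge(5)[OF f] by blast
    then have "bcopy p a \<in> bcopy q ` g"
      using eq by blast
    then have "p = q"
      by simp
    moreover have "f = g"
      using eq inj_bcopy \<open>p = q\<close> by (metis inj_image_eq_iff)
    ultimately show "c = d"
      using cd by simp
  qed
  have injB: "inj_on (\<lambda>(p, j). hub_edge p j) (P \<times> I)"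
    by (rule inj_onI) (auto simp: hub_edge_def doubleton_eq_iff)
  have injC: "inj_on link P"
    by (rule inj_onI) (use x_neq_y in \<open>auto simp only: link_def doubleton_eq_iff bcopy_eq_iff\<close>)
  have "bcopy p ` f \<noteq> hub_edge q j" for p q f j
  proof
    assume "bcopy p ` f = hub_edge q j"
    then have "Hub (fst q) j \<in> bcopy p ` f"
      by (simp only: hub_edge_def insert_iff simp_thms)
    then show False
      by auto
  qed
  then have AB: "?A \<inter> ?B = {}"
    by auto
  have "bcopy p ` f \<noteq> link q" if "q \<in> P" for p q f
  proof
    assume eq: "bcopy p ` f = link q"
    then have "bcopy q x \<in> bcopy p ` f" "bcopy (partner q) y \<in> bcopy p ` f"
      by (auto simp only: eq link_def insert_iff)
    then show False
      using partner_neq[OF that] by auto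
  qed
  moreover have "hub_edge p j \<noteq> link q" for p q j
    by (auto simp: hub_edge_def link_def doubleton_eq_iff)
  ultimately have C: "(?A \<union> ?B) \<inter> link ` P = {}"
    by auto metis+
  have "sum g (edges T) = sum g (?A \<union> ?B) + sum g (link ` P)"
    unfolding edges_T using C finite_P finite_brick_edges by (intro sum.union_disjoint) auto
  also have "sum g (?A \<union> ?B) = sum g ?A + sum g ?B"
    using AB finite_P finite_brick_edges by (intro sum.union_disjoint) auto
  also have "sum g ?A = (\<Sum>p\<in>P. \<Sum>f\<in>brick_edges. g (bcopy p ` f))"
    by (subst sum.reindex[OF injA]) (simp only: sum.cartesian_product o_def split_def)
  also have "sum g ?B = (\<Sum>p\<in>P. \<Sum>j\<in>I. g (hub_edge p j))"
    by (subst sum.reindex[OF injB]) (simp only: sum.cartesian_product o_def split_def)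
  also have "sum g (link ` P) = (\<Sum>p\<in>P. g (link p))"
    by (subst sum.reindex[OF injC]) (simp only: o_def)
  finally show ?thesis
    by (simp only: sum.distrib)
qed

lemma simple_T: "simple_graph T"
proof -
  have "f \<subseteq> verts T \<and> card f = 2" if f: "f \<in> edges T" for f
  proof -
    consider p f' where "p \<in> P" "f' \<in> brick_edges" "f = bcopy p ` f'"
      | p j where "p \<in> P" "j \<in> I" "f = hub_edge p j" | p where "p \<in> P" "f = link p"
      using f unfolding edges_T by blast
    then show ?thesis
    proof cases
      case 1
      then show ?thesis
        using brick_edge(4,6)[OF 1(2)] card_image[OF inj_on_subset[OF inj_bcopy subset_UNIV], of p f']
        by (auto simp: bcopy_in_verts)
    next
      case 2
      then show ?thesis
        using w_verts[OF 2(2)] w_neq_v[OF 2(2)]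
        by (auto simp: hub_edge_def bcopy_in_verts Hub_in_verts in_P_iff)
    next
      case 3
      then show ?thesis
        using far xy_verts partner_in_P[OF 3(1)] x_neq_y
        by (auto simp: link_def bcopy_in_verts)
    qed
  qed
  moreover have "finite (verts T)"
    unfolding verts_T using finite_P finite_V by auto
  ultimately show ?thesis
    by (simp add: simple_graph_def)
qed

text \<open>Has the shape of \<open>sum_edges_G_at\<close>, with hub edges in place of the edges at
  \<open>v\<close>. The edge \<open>{x, y}\<close> is replaced by \<open>link q\<close> at
  \<open>x\<close> and by \<open>link (partner q)\<close> at \<open>y\<close>.\<close>

lemma sum_edges_T_at_copy:
  fixes h :: "('a, 'u) tvertex set \<Rightarrow> nat"
  assumes q: "q \<in> P"
  shows "(\<Sum>f\<in>edges T. h f * of_bool (bcopy q c \<in> f)) =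
    (\<Sum>f\<in>brick_edges. h (bcopy q ` f) * of_bool (c \<in> f)) +
    (\<Sum>j\<in>I. h (hub_edge q j) * of_bool (c = w j)) +
    h (link q) * of_bool (c = x) + h (link (partner q)) * of_bool (c = y)"
proof -
  have 1: "(\<Sum>p\<in>P. \<Sum>f\<in>brick_edges. h (bcopy p ` f) * of_bool (bcopy q c \<in> bcopy p ` f)) =
      (\<Sum>p\<in>P. if q = p then \<Sum>f\<in>brick_edges. h (bcopy p ` f) * of_bool (c \<in> f) else 0)"
    by (rule sum.cong) auto
  have 2: "(\<Sum>p\<in>P. \<Sum>j\<in>I. h (hub_edge p j) * of_bool (bcopy q c \<in> hub_edge p j)) =
      (\<Sum>p\<in>P. if q = p then \<Sum>j\<in>I. h (hub_edge p j) * of_bool (c = w j) else 0)"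
    by (rule sum.cong) (auto simp: hub_edge_def)
  have 3: "(\<Sum>p\<in>P. h (link p) * of_bool (bcopy q c \<in> link p)) =
      (\<Sum>p\<in>P. (if q = p then h (link p) * of_bool (c = x) else 0) +
        (if partner q = p then h (link p) * of_bool (c = y) else 0))"
  proof (rule sum.cong)
    fix p assume p: "p \<in> P"
    have "bcopy q c \<in> link p \<longleftrightarrow> q = p \<and> c = x \<or> partner q = p \<and> c = y"
      using partner_eq_iff[OF q p] by (auto simp: link_def)
    then show "h (link p) * of_bool (bcopy q c \<in> link p) =
      (if q = p then h (link p) * of_bool (c = x) else 0) +
        (if partner q = p then h (link p) * of_bool (c = y) else 0)"
      using x_neq_y partner_neq[OF q] by auto
  qed simp
  show ?thesis
    unfolding sum_edges_T sum.distrib 1 2 3 sum.delta'[OF finite_P] sum.delta[OF finite_P]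
    using q partner_in_P[OF q] by (simp only: if_True)
qed

lemma sum_edges_T_at_Hub:
  fixes h :: "('a, 'u) tvertex set \<Rightarrow> nat"
  assumes u: "u \<in> mverts M" and j: "j \<in> I"
  shows "(\<Sum>f\<in>edges T. h f * of_bool (Hub u j \<in> f)) = (\<Sum>i\<in>I. h (hub_edge (u, i) j))"
proof -
  have "(\<Sum>f\<in>edges T. h f * of_bool (Hub u j \<in> f)) =
    (\<Sum>p\<in>P. if fst p = u then h (hub_edge p j) else 0)"
    unfolding sum_edges_T
  proof (rule sum.cong)
    fix p assume "p \<in> P"
    have 1: "Hub u j \<notin> bcopy p ` f" "Hub u j \<notin> link p" for f
      by (auto simp: link_def)
    have "(\<Sum>k\<in>I. h (hub_edge p k) * of_bool (Hub u j \<in> hub_edge p k)) =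
      (\<Sum>k\<in>I. if j = k then (if fst p = u then h (hub_edge p k) else 0) else 0)"
      by (rule sum.cong) (auto simp: hub_edge_def)
    also have "\<dots> = (if fst p = u then h (hub_edge p j) else 0)"
      using j by (subst sum.delta') auto
    finally show "(\<Sum>f\<in>brick_edges. h (bcopy p ` f) * of_bool (Hub u j \<in> bcopy p ` f)) +
         (\<Sum>k\<in>I. h (hub_edge p k) * of_bool (Hub u j \<in> hub_edge p k)) +
         h (link p) * of_bool (Hub u j \<in> link p) = (if fst p = u then h (hub_edge p j) else 0)"
      by (simp only: 1) simp
  qed simp
  also have "\<dots> = (\<Sum>u'\<in>mverts M. \<Sum>i\<in>I. if u' = u then h (hub_edge (u', i) j) else 0)"
    by (simp only: sum_P fst_conv)
  also have "\<dots> = (\<Sum>u'\<in>mverts M. if u' = u then \<Sum>i\<in>I. h (hub_edge (u', i) j) else 0)"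
    by (rule sum.cong) auto
  also have "\<dots> = (\<Sum>i\<in>I. h (hub_edge (u, i) j))"
    using u finite_mverts by (subst sum.delta) auto
  finally show ?thesis .
qed

lemma sum_edges_G_at:
  fixes h :: "'a set \<Rightarrow> nat"
  assumes "c \<noteq> v"
  shows "(\<Sum>f\<in>edges G. h f * of_bool (c \<in> f)) =
    (\<Sum>f\<in>brick_edges. h f * of_bool (c \<in> f)) + (\<Sum>j\<in>I. h {v, w j} * of_bool (c = w j)) +
    h {x, y} * of_bool (c = x) + h {x, y} * of_bool (c = y)"
  unfolding sum_edges_G using assms x_neq_y by auto

lemma sum_edges_G_at_v:
  fixes h :: "'a set \<Rightarrow> nat"
  shows "(\<Sum>f\<in>edges G. h f * of_bool (v \<in> f)) = (\<Sum>j\<in>I. h {v, w j})"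
  unfolding sum_edges_G using brick_edge(2) far by auto

text \<open>With weight 1 the edge sum at a copy of \<open>c\<close> agrees with the one at
  \<open>c\<close> in \<open>G\<close>; a hub has one edge to each of its three bricks.\<close>

lemma cubic_T: "cubic_graph T"
proof -
  have "card {f \<in> edges T. a \<in> f} = 3" if a: "a \<in> verts T" for a
  proof -
    have card: "card {f \<in> edges T. a \<in> f} = (\<Sum>f\<in>edges T. 1 * of_bool (a \<in> f))"
      by (simp only: card_eq_sum_of_bool[OF simple_graph_finite_edges[OF simple_T]] mult_1)
    from a show ?thesis
    proof (cases rule: verts_T_cases)
      case (1 q c)
      have "3 = card {f \<in> edges G. c \<in> f}"
        using cG 1 by (simp add: cubic_graph_def)
      also have "\<dots> = (\<Sum>f\<in>edges G. 1 * of_bool (c \<in> f))"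
        by (simp only: card_eq_sum_of_bool[OF finite_E] mult_1)
      also have "\<dots> = (\<Sum>f\<in>edges T. 1 * of_bool (bcopy q c \<in> f))"
        unfolding sum_edges_T_at_copy[OF 1(1), of "\<lambda>_. 1"] using 1(2)
        by (intro sum_edges_G_at) simp
      finally show ?thesis
        using card 1(3) by metis
    next
      case (2 u j)
      have "(\<Sum>f\<in>edges T. 1 * of_bool (a \<in> f)) = (\<Sum>i\<in>I. 1 :: nat)"
        unfolding 2(3) by (rule sum_edges_T_at_Hub[OF 2(1,2), of "\<lambda>_. 1"])
      then show ?thesis
        using card by simp
    qed
  qed
  then show ?thesis
    using simple_T by (simp add: cubic_graph_def)
qed

section \<open>Cuts of a brick\<close>

text \<open>
  For a vertex set of the construction meeting a brick in \<open>Q\<close> and its hubs in \<open>Z\<close>, \<open>bcost Q Z\<close>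
  counts the cut edges inside the brick or between the brick and the hubs, and \<open>bdev Q\<close> the ends
  of linking edges that lie in \<open>Q\<close>.
\<close>

definition bcost :: "'a set \<Rightarrow> nat set \<Rightarrow> nat" where
  "bcost Q Z = card {f \<in> brick_edges. crosses Q f} + (\<Sum>j\<in>I. of_bool ((j \<in> Z) \<noteq> (w j \<in> Q)))"

definition bdev :: "'a set \<Rightarrow> nat" where
  "bdev Q = of_bool (x \<in> Q) + of_bool (y \<in> Q)"

lemma boundary_G_split:
  assumes "v \<notin> Q"
  shows "card (boundary G Q) = card {f \<in> brick_edges. crosses Q f} +
    (\<Sum>j\<in>I. of_bool (w j \<in> Q)) + of_bool ((x \<in> Q) \<noteq> (y \<in> Q))"
  unfolding boundary_def card_eq_sum_of_bool[OF finite_E] card_eq_sum_of_bool[OF finite_brick_edges]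
    sum_edges_G crosses_doubleton using assms by simp

text \<open>With all hubs outside, hub edges are cut exactly as the edges at \<open>v\<close> are in
  \<open>G\<close>; only the deleted edge \<open>{x, y}\<close> has to be added back.\<close>

lemma bcost_no_hub:
  assumes "v \<notin> Q"
  shows "bcost Q {} + of_bool ((x \<in> Q) \<noteq> (y \<in> Q)) = card (boundary G Q)"
  unfolding bcost_def boundary_G_split[OF assms] by simp

text \<open>Moving hub \<open>k\<close> inside flips the status of a single edge, the one to
  \<open>w k\<close>: the cost grows by 1 if \<open>w k\<close> is outside \<open>Q\<close> and
  drops by 1 otherwise.\<close>

lemma bcost_one_hub:
  assumes "v \<notin> Q" "k \<in> I"
  shows "bcost Q {k} + of_bool ((x \<in> Q) \<noteq> (y \<in> Q)) + 2 * of_bool (w k \<in> Q) = card (boundary G Q) + 1"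
proof -
  have "(\<Sum>j\<in>I. of_bool ((j \<in> {k}) \<noteq> (w j \<in> Q))) + 2 * of_bool (w k \<in> Q) =
    (\<Sum>j\<in>I. of_bool (w j \<in> Q)) + (1::nat)"
    using assms(2) unfolding sum_I by (auto simp: I_def)
  then show ?thesis
    unfolding bcost_def boundary_G_split[OF assms(1)] by linarith
qed

lemma bcost_compl: "bcost (verts G - {v} - Q) (I - Z) = bcost Q Z"
proof -
  have "crosses (verts G - {v} - Q) f \<longleftrightarrow> crosses Q f" if "f \<in> brick_edges" for f
    using brick_edge(4)[OF that] by (auto simp: crosses_def)
  then have 1: "{f \<in> brick_edges. crosses (verts G - {v} - Q) f} = {f \<in> brick_edges. crosses Q f}"
    by blast
  have 2: "(\<Sum>j\<in>I. of_bool ((j \<in> I - Z) \<noteq> (w j \<in> verts G - {v} - Q))) =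
    (\<Sum>j\<in>I. of_bool ((j \<in> Z) \<noteq> (w j \<in> Q)) :: nat)"
    using w_verts w_neq_v by (intro sum.cong) auto
  show ?thesis
    unfolding bcost_def 1 2 ..
qed

text \<open>The boundary is a cyclic 4-cut, so it separates \<open>x\<close> from the component of
  \<open>v\<close>. The side of \<open>v\<close> is connected, hence \<open>x\<close> lies in
  \<open>Q\<close>; and \<open>y\<close> does too, since no cut edge ends in
  \<open>x\<close>.\<close>

lemma four_cut:
  assumes Q: "Q \<subseteq> verts G - {v}" "3 \<le> card Q" "3 \<le> card (verts G - Q)"
    and d: "card (boundary G Q) = 4"
  shows "x \<in> Q \<and> y \<in> Q"
proof -
  let ?H = "delete_edges G (boundary G Q)"
  have "cyclic_edge_cut G (boundary G Q)"
    using Q d by (intro small_boundary_cyclic_edge_cut[OF cG]) auto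
  note cut = cut4[OF this d]
  have x: "x \<in> Q"
  proof (rule ccontr)
    assume "x \<notin> Q"
    have "Q \<noteq> {}"
      using Q(2) by auto
    then have ne: "verts G - Q \<noteq> verts G"
      using Q(1) by blast
    have "x \<in> component (delete_edges G (boundary G (verts G - Q))) v"
      using Q v xy_verts \<open>x \<notin> Q\<close> ne d boundary_compl[OF sG, of Q]
      by (intro cyclically_4_connected_cut_sides_connected[OF cyc4]) auto
    then have "x \<in> component ?H v"
      by (simp add: boundary_compl[OF sG])
    moreover have "x \<in> component ?H x"
      using xy_verts by (intro component_self) (simp add: delete_edges_def)
    ultimately show False
      using components_disjoint[OF simple_graph_delete_edges[OF sG], of v "boundary G Q" x] cut v xy_verts
      by (auto simp: delete_edges_def)
  qed
  moreover have "y \<in> Q"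
  proof (rule ccontr)
    assume "y \<notin> Q"
    then have "{x, y} \<in> boundary G Q"
      using x xy by (simp add: boundary_def)
    then show False
      using cut by blast
  qed
  ultimately show ?thesis
    by simp
qed

text \<open>Two non-adjacent vertices span no edge. This settles the case that everything but
  \<open>v\<close> and one of \<open>x\<close>, \<open>y\<close> lies in \<open>Q\<close>.\<close>

lemma far_pair_cut:
  assumes "a = x \<or> a = y"
  shows "card (boundary G {v, a}) = 6"
proof -
  have "{v, a} \<notin> edges G" "a \<noteq> v" "a \<in> verts G"
    using assms far xy_verts by auto
  have "{f \<in> edges G. f \<subseteq> {v, a}} = {}"
  proof (rule equals0I)
    fix f assume f: "f \<in> {f \<in> edges G. f \<subseteq> {v, a}}"
    then have "card f = 2"
      using sG by (simp add: simple_graph_def)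
    then have "f = {v, a}"
      using f \<open>a \<noteq> v\<close> by (intro card_subset_eq) auto
    then show False
      using f \<open>{v, a} \<notin> edges G\<close> by blast
  qed
  then have "card {f \<in> edges G. f \<subseteq> {v, a}} = 0"
    by (simp only: card.empty)
  moreover have "card {v, a} = 2"
    using \<open>a \<noteq> v\<close> by simp
  moreover have "{v, a} \<subseteq> verts G"
    using v \<open>a \<in> verts G\<close> by blast
  ultimately show ?thesis
    using cubic_graph_handshake[OF cG, of "{v, a}"] by linarith
qed

text \<open>The alternative that \<open>Q\<close> contains both \<open>x\<close> and
  \<open>y\<close> absorbs the 4-cuts allowed by the hypotheses and the complements with too few
  vertices for a cycle. There \<open>bdev Q = 2\<close> makes up for the smaller cut.\<close>

lemma brick_cut_facts:
  assumes Q: "Q \<subseteq> verts G - {v}" "Q \<noteq> {}"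
  shows "3 \<le> card (boundary G Q)"
    and "2 \<le> card Q \<Longrightarrow> 4 \<le> card (boundary G Q) \<or> x \<in> Q \<and> y \<in> Q"
    and "3 \<le> card Q \<Longrightarrow> 5 \<le> card (boundary G Q) \<or> x \<in> Q \<and> y \<in> Q"
proof -
  show d3: "3 \<le> card (boundary G Q)"
    using Q v by (intro cyclically_4_connected_cut_ge_3[OF cyc4]) auto
  have finVQ: "finite (verts G - Q)" "v \<in> verts G - Q"
    using finite_V Q v by auto
  then have pos: "card (verts G - Q) \<noteq> 0"
    by auto
  have one: "x \<in> Q \<and> y \<in> Q" if "card (verts G - Q) = 1"
  proof -
    have "verts G - Q = {v}"
      using that finVQ by (metis card_1_singletonE singletonD)
    then show ?thesis
      using far xy_verts by blast
  qed
  show d4: "4 \<le> card (boundary G Q) \<or> x \<in> Q \<and> y \<in> Q" if "2 \<le> card Q"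
  proof (cases "card (verts G - Q) = 1")
    case False
    then have "2 \<le> card (verts G - Q)"
      using pos by linarith
    then show ?thesis
      using cyclically_4_connected_cut_ge_4[OF cyc4, of Q] Q that by blast
  qed (use one in blast)
  show "5 \<le> card (boundary G Q) \<or> x \<in> Q \<and> y \<in> Q" if "3 \<le> card Q"
  proof -
    consider "card (verts G - Q) = 1" | "card (verts G - Q) = 2" | "3 \<le> card (verts G - Q)"
      using pos by linarith
    then show ?thesis
    proof cases
      case 1
      then show ?thesis
        using one by blast
    next
      case 2
      then obtain a where a: "verts G - Q = {v, a}" "a \<noteq> v"
        using finVQ by (metis card_2_iff doubleton_eq_iff insert_iff singletonD)
      show ?thesis
      proof (cases "a = x \<or> a = y")
        case True
        then have "card (boundary G Q) = 6"
          using far_pair_cut[of a] boundary_compl[OF sG, of Q] a by simp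
        then show ?thesis
          by simp
      next
        case False
        then show ?thesis
          using a far xy_verts by blast
      qed
    next
      case 3
      then show ?thesis
        using four_cut[OF Q(1) that 3] d4 that by linarith
    qed
  qed
qed

text \<open>Let d be the size of the boundary of \<open>Q\<close> in \<open>G\<close>. Then
  \<open>bcost Q {} + bdev Q\<close> is d + 2 if both \<open>x\<close> and \<open>y\<close> are in
  \<open>Q\<close>, and d otherwise; the cost itself is d - 1 if exactly one is, and d
  otherwise.\<close>

lemma brick_no_hub:
  assumes "Q \<subseteq> verts G - {v}"
  shows "bdev Q \<le> bcost Q {}"
    and "Q \<noteq> {} \<Longrightarrow> 2 \<le> bcost Q {}"
    and "Q \<noteq> {} \<Longrightarrow> 3 \<le> bcost Q {} + bdev Q"
    and "2 \<le> card Q \<Longrightarrow> 3 \<le> bcost Q {}"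
    and "3 \<le> card Q \<Longrightarrow> 5 \<le> bcost Q {} + bdev Q"
proof -
  have eq: "bcost Q {} + of_bool ((x \<in> Q) \<noteq> (y \<in> Q)) = card (boundary G Q)"
    using bcost_no_hub assms by blast
  note facts = brick_cut_facts[OF assms]
  show "bdev Q \<le> bcost Q {}"
    using eq facts(1) by (cases "Q = {}") (auto simp: bdev_def split: if_splits)
  show "2 \<le> bcost Q {}" "3 \<le> bcost Q {} + bdev Q" if "Q \<noteq> {}"
    using eq facts(1)[OF that] by (cases "x \<in> Q"; cases "y \<in> Q"; auto simp: bdev_def)+
  show "3 \<le> bcost Q {}" if "2 \<le> card Q"
  proof -
    have "Q \<noteq> {}"
      using that by auto
    then show ?thesis
      using eq facts(1) facts(2)[OF _ that] by (cases "x \<in> Q"; cases "y \<in> Q") auto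
  qed
  show "5 \<le> bcost Q {} + bdev Q" if "3 \<le> card Q"
  proof -
    have "Q \<noteq> {}"
      using that by auto
    then show ?thesis
      using eq facts(1) facts(3)[OF _ that] by (cases "x \<in> Q"; cases "y \<in> Q") (auto simp: bdev_def)
  qed
qed

lemma brick_one_hub:
  assumes "Q \<subseteq> verts G - {v}" "k \<in> I"
  shows "bdev Q \<le> bcost Q {k}"
    and "1 \<le> bcost Q {k}"
    and "Q \<noteq> {} \<Longrightarrow> 2 \<le> bcost Q {k}"
    and "2 \<le> card Q \<Longrightarrow> 3 \<le> bcost Q {k} + bdev Q"
proof -
  have eq: "bcost Q {k} + of_bool ((x \<in> Q) \<noteq> (y \<in> Q)) + 2 * of_bool (w k \<in> Q) = card (boundary G Q) + 1"
    using bcost_one_hub assms by blast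
  note facts = brick_cut_facts[OF assms(1)]
  have fin: "finite Q"
    using assms finite_V finite_subset by blast
  \<comment> \<open>The worst case, in which the cost is only two less than the boundary in
    \<open>G\<close>. Since \<open>w k\<close> is adjacent to \<open>v\<close> but \<open>x\<close>
    and \<open>y\<close> are not, \<open>Q\<close> has two vertices and its boundary at least 4
    edges.\<close>
  have sep: "2 \<le> card Q" if "(x \<in> Q) \<noteq> (y \<in> Q)" "w k \<in> Q"
  proof -
    define z where "z = (if x \<in> Q then x else y)"
    have "z \<in> Q"
      using that(1) by (auto simp: z_def)
    have "z \<noteq> w k"
      using far(3,4) vw_edge[OF assms(2)] by (auto simp: z_def)
    then have "card {z, w k} = 2"
      by simp
    then show ?thesis
      using card_mono[OF fin, of "{z, w k}"] \<open>z \<in> Q\<close> that(2) by simp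
  qed
  have ne: "2 \<le> bcost Q {k} \<and> bdev Q \<le> bcost Q {k} \<and> (2 \<le> card Q \<longrightarrow> 3 \<le> bcost Q {k} + bdev Q)"
    if "Q \<noteq> {}"
  proof (cases "w k \<in> Q")
    case True
    then show ?thesis
      using eq sep facts(1,2)[OF that] by (cases "x \<in> Q"; cases "y \<in> Q") (auto simp: bdev_def)
  next
    case False
    then show ?thesis
      using eq facts(1)[OF that] by (cases "x \<in> Q"; cases "y \<in> Q") (auto simp: bdev_def)
  qed
  have e: "1 \<le> bcost Q {k} \<and> bdev Q = 0" if "Q = {}"
    using eq that by (auto simp: bdev_def)
  show "bdev Q \<le> bcost Q {k}" "1 \<le> bcost Q {k}"
    using ne e by (cases "Q = {}"; force)+
  show "2 \<le> bcost Q {k}" if "Q \<noteq> {}"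
    using ne that by blast
  show "3 \<le> bcost Q {k} + bdev Q" if "2 \<le> card Q"
    using ne that by force
qed

section \<open>Cuts of a triple\<close>

definition slice :: "('a, 'u) tvertex set \<Rightarrow> 'u \<times> nat \<Rightarrow> 'a set" where
  "slice S p = {a. bcopy p a \<in> S}"

definition hubs :: "('a, 'u) tvertex set \<Rightarrow> 'u \<Rightarrow> nat set" where
  "hubs S u = {j \<in> I. Hub u j \<in> S}"

definition tcost :: "('a, 'u) tvertex set \<Rightarrow> 'u \<Rightarrow> nat" where
  "tcost S u = (\<Sum>i\<in>I. bcost (slice S (u, i)) (hubs S u))"

definition tdev :: "('a, 'u) tvertex set \<Rightarrow> 'u \<Rightarrow> nat" where
  "tdev S u = (\<Sum>i\<in>I. bdev (slice S (u, i)))"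

definition tsize :: "('a, 'u) tvertex set \<Rightarrow> 'u \<Rightarrow> nat" where
  "tsize S u = (\<Sum>i\<in>I. card (slice S (u, i))) + card (hubs S u)"

text \<open>
  A set is sparse at \<open>u\<close> if it is the small side of the cut it induces on the triple: removing it
  from the triple at \<open>u\<close> does not increase the boundary, because \<open>tdev \<le> tcost\<close>.
\<close>

definition sparse :: "('a, 'u) tvertex set \<Rightarrow> 'u \<Rightarrow> bool" where
  "sparse S u \<longleftrightarrow> tdev S u \<le> tcost S u \<and> (1 \<le> tsize S u \<longrightarrow> 2 \<le> tcost S u) \<and>
     (2 \<le> tsize S u \<longrightarrow> 3 \<le> tcost S u) \<and> (3 \<le> tsize S u \<longrightarrow> 5 \<le> tcost S u + tdev S u)"

lemma slice_subset: "S \<subseteq> verts T \<Longrightarrow> slice S p \<subseteq> verts G - {v}"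
  using bcopy_in_verts[of p] by (auto simp: slice_def)

lemma finite_slice: "S \<subseteq> verts T \<Longrightarrow> finite (slice S p)"
  by (rule finite_subset[OF slice_subset]) (simp_all add: finite_V)

lemma slice_compl: "p \<in> P \<Longrightarrow> slice (verts T - S) p = verts G - {v} - slice S p"
  using bcopy_in_verts[of p] by (auto simp: slice_def)

lemma hubs_compl: "u \<in> mverts M \<Longrightarrow> hubs (verts T - S) u = I - hubs S u"
  using Hub_in_verts by (auto simp: hubs_def)

lemma tcost_compl:
  assumes "u \<in> mverts M"
  shows "tcost (verts T - S) u = tcost S u"
  unfolding tcost_def
proof (rule sum.cong)
  fix i assume "i \<in> I"
  then have "(u, i) \<in> P"
    using assms by (simp add: in_P_iff)
  then show "bcost (slice (verts T - S) (u, i)) (hubs (verts T - S) u) = bcost (slice S (u, i)) (hubs S u)"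
    using assms bcost_compl by (simp add: slice_compl hubs_compl)
qed simp

text \<open>Inside a triple the bricks are joined only through hubs, so for a fixed set of hubs
  their costs add up and the bounds for single bricks can be combined.\<close>

lemma sparse_few_hubs:
  assumes S: "S \<subseteq> verts T" and u: "u \<in> mverts M" and Z: "card (hubs S u) \<le> 1"
  shows "sparse S u"
proof -
  let ?Q = "\<lambda>i. slice S (u, i)"
  have Q: "?Q i \<subseteq> verts G - {v}" and finQ: "finite (?Q i)" for i
    by (rule slice_subset[OF S], rule finite_slice[OF S])
  have finZ: "finite (hubs S u)"
    by (simp add: hubs_def)
  show ?thesis
  proof (cases "hubs S u = {}")
    case True
    note b = brick_no_hub[OF Q]
    have tc: "tcost S u = bcost (?Q 1) {} + bcost (?Q 2) {} + bcost (?Q 3) {}"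
      "tdev S u = bdev (?Q 1) + bdev (?Q 2) + bdev (?Q 3)"
      "tsize S u = card (?Q 1) + card (?Q 2) + card (?Q 3)"
      by (simp_all add: tcost_def tdev_def tsize_def sum_I True)
    have f: "bdev (?Q i) \<le> bcost (?Q i) {}" "card (?Q i) = 0 \<or> 2 \<le> bcost (?Q i) {}"
      "card (?Q i) = 0 \<or> 3 \<le> bcost (?Q i) {} + bdev (?Q i)"
      "card (?Q i) \<le> 1 \<or> 3 \<le> bcost (?Q i) {}"
      "card (?Q i) \<le> 2 \<or> 5 \<le> bcost (?Q i) {} + bdev (?Q i)" for i
    proof -
      show "bdev (?Q i) \<le> bcost (?Q i) {}"
        by (rule b(1))
      show "card (?Q i) = 0 \<or> 2 \<le> bcost (?Q i) {}" "card (?Q i) = 0 \<or> 3 \<le> bcost (?Q i) {} + bdev (?Q i)"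
        using b(2,3)[of i] unfolding card_0_eq[OF finQ] by blast+
      show "card (?Q i) \<le> 1 \<or> 3 \<le> bcost (?Q i) {}"
        using b(4)[of i] by (cases "2 \<le> card (?Q i)") simp_all
      show "card (?Q i) \<le> 2 \<or> 5 \<le> bcost (?Q i) {} + bdev (?Q i)"
        using b(5)[of i] by (cases "3 \<le> card (?Q i)") simp_all
    qed
    show ?thesis
      unfolding sparse_def tc by (rule three_bricks_no_hub_arith[OF f[of 1] f[of 2] f[of 3]])
  next
    case False
    then obtain k where k: "hubs S u = {k}" "k \<in> I"
    proof -
      have "card (hubs S u) = 1"
        using Z False finZ by (simp add: le_Suc_eq)
      then obtain k where k: "hubs S u = {k}"
        by (rule card_1_singletonE)
      moreover have "k \<in> I"
        using k by (auto simp: hubs_def)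
      ultimately show ?thesis
        by (rule that)
    qed
    note b = brick_one_hub[OF Q k(2)]
    have tc: "tcost S u = bcost (?Q 1) {k} + bcost (?Q 2) {k} + bcost (?Q 3) {k}"
      "tdev S u = bdev (?Q 1) + bdev (?Q 2) + bdev (?Q 3)"
      "tsize S u = card (?Q 1) + card (?Q 2) + card (?Q 3) + 1"
      by (simp_all add: tcost_def tdev_def tsize_def sum_I k(1))
    have f: "bdev (?Q i) \<le> bcost (?Q i) {k}" "1 \<le> bcost (?Q i) {k}"
      "card (?Q i) = 0 \<or> 2 \<le> bcost (?Q i) {k}"
      "card (?Q i) \<le> 1 \<or> 3 \<le> bcost (?Q i) {k} + bdev (?Q i)" for i
    proof -
      show "bdev (?Q i) \<le> bcost (?Q i) {k}" "1 \<le> bcost (?Q i) {k}"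
        by (rule b)+
      show "card (?Q i) = 0 \<or> 2 \<le> bcost (?Q i) {k}"
        using b(3)[of i] unfolding card_0_eq[OF finQ] by blast
      show "card (?Q i) \<le> 1 \<or> 3 \<le> bcost (?Q i) {k} + bdev (?Q i)"
        using b(4)[of i] by (cases "2 \<le> card (?Q i)") simp_all
    qed
    show ?thesis
      unfolding sparse_def tc by (rule three_bricks_one_hub_arith[OF f[of 1] f[of 2] f[of 3]])
  qed
qed

text \<open>Of the three hubs of a triple, at most one lies on one of the two sides.\<close>

lemma sparse_or_compl:
  assumes S: "S \<subseteq> verts T" and u: "u \<in> mverts M"
  shows "sparse S u \<or> sparse (verts T - S) u"
proof (cases "card (hubs S u) \<le> 1")
  case True
  then show ?thesis
    using sparse_few_hubs[OF S u] by blast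
next
  case False
  have "card (hubs (verts T - S) u) = 3 - card (hubs S u)"
    unfolding hubs_compl[OF u] by (subst card_Diff_subset) (auto simp: hubs_def)
  then have "card (hubs (verts T - S) u) \<le> 1"
    using False by linarith
  then show ?thesis
    using sparse_few_hubs[of "verts T - S" u] u by blast
qed

section \<open>Cyclic connectivity of the construction\<close>

lemma boundary_T_split:
  "card (boundary T S) = (\<Sum>u\<in>mverts M. tcost S u) +
    (\<Sum>p\<in>P. of_bool ((x \<in> slice S p) \<noteq> (y \<in> slice S (partner p))))"
proof -
  have cr: "crosses S (bcopy p ` f) \<longleftrightarrow> crosses (slice S p) f" for p f
    by (auto simp: crosses_def slice_def)
  have "card (boundary T S) = (\<Sum>p\<in>P. (\<Sum>f\<in>brick_edges. of_bool (crosses S (bcopy p ` f))) +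
      (\<Sum>j\<in>I. of_bool (crosses S (hub_edge p j))) + of_bool (crosses S (link p)))"
    unfolding boundary_def card_eq_sum_of_bool[OF simple_graph_finite_edges[OF simple_T]] sum_edges_T ..
  also have "\<dots> = (\<Sum>p\<in>P. bcost (slice S p) (hubs S (fst p)) +
      of_bool ((x \<in> slice S p) \<noteq> (y \<in> slice S (partner p))))"
  proof (rule sum.cong)
    fix p assume "p \<in> P"
    have "(\<Sum>j\<in>I. of_bool (crosses S (hub_edge p j))) =
      (\<Sum>j\<in>I. of_bool ((j \<in> hubs S (fst p)) \<noteq> (w j \<in> slice S p)) :: nat)"
      by (rule sum.cong) (auto simp: hub_edge_def hubs_def slice_def)
    then show "(\<Sum>f\<in>brick_edges. of_bool (crosses S (bcopy p ` f))) +
      (\<Sum>j\<in>I. of_bool (crosses S (hub_edge p j))) + of_bool (crosses S (link p)) =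
      bcost (slice S p) (hubs S (fst p)) + of_bool ((x \<in> slice S p) \<noteq> (y \<in> slice S (partner p)))"
      unfolding bcost_def card_eq_sum_of_bool[OF finite_brick_edges] cr link_def crosses_doubleton
      by (simp only: slice_def mem_Collect_eq)
  qed simp
  finally show ?thesis
    by (simp only: sum.distrib sum_P tcost_def fst_conv)
qed

lemma card_eq_sum_tsize:
  assumes S: "S \<subseteq> verts T"
  shows "card S = (\<Sum>u\<in>mverts M. tsize S u)"
proof -
  let ?A = "(\<lambda>(p, a). bcopy p a) ` (SIGMA p:P. slice S p)"
  let ?B = "case_prod Hub ` (SIGMA u:mverts M. hubs S u) :: ('a, 'u) tvertex set"
  have "S = ?A \<union> ?B"
  proof (intro equalityI subsetI)
    fix a assume a: "a \<in> S"
    with S have "a \<in> verts T"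
      by blast
    then show "a \<in> ?A \<union> ?B"
    proof (cases rule: verts_T_cases)
      case (1 q c)
      then show ?thesis
        using a by (intro UnI1 image_eqI[of _ _ "(q, c)"]) (auto simp: slice_def)
    next
      case (2 u j)
      then show ?thesis
        using a by (intro UnI2 image_eqI[of _ _ "(u, j)"]) (auto simp: hubs_def)
    qed
  qed (auto simp: slice_def hubs_def)
  moreover have "card (?A \<union> ?B) = card ?A + card ?B"
    using finite_P finite_slice[OF S] finite_mverts by (intro card_Un_disjoint) (auto simp: hubs_def)
  moreover have "card ?A = (\<Sum>p\<in>P. card (slice S p))"
    using finite_P finite_slice[OF S] by (subst card_image) (auto simp: inj_on_def intro!: card_SigmaI)
  moreover have "card ?B = (\<Sum>u\<in>mverts M. card (hubs S u))"
    using finite_mverts by (subst card_image) (auto simp: inj_on_def hubs_def intro!: card_SigmaI)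
  ultimately show ?thesis
    by (simp only: tsize_def sum.distrib sum_P)
qed

lemma tsize_0_slice:
  assumes "S \<subseteq> verts T" "tsize S (fst p) = 0" "p \<in> P"
  shows "slice S p = {}"
proof -
  have "card (slice S (fst p, snd p)) = 0"
    using assms by (auto simp: tsize_def in_P_iff)
  then show ?thesis
    using finite_slice[OF assms(1)] by simp
qed

text \<open>When \<open>S\<close> lies in the triple at \<open>u\<close>, all partner bricks are
  empty, so every copy of \<open>x\<close> or \<open>y\<close> in \<open>S\<close> ends a cut
  linking edge. The edges counted at \<open>x\<close> have index at \<open>u\<close>, those counted
  at \<open>y\<close> have index elsewhere, so none is counted twice.\<close>

lemma links_ge_tdev:
  assumes S: "S \<subseteq> verts T" and u: "u \<in> mverts M"
    and others: "\<And>u'. u' \<in> mverts M \<Longrightarrow> u' \<noteq> u \<Longrightarrow> tsize S u' = 0"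
  shows "tdev S u \<le> (\<Sum>p\<in>P. of_bool ((x \<in> slice S p) \<noteq> (y \<in> slice S (partner p))))"
proof -
  let ?g = "\<lambda>p. of_bool ((x \<in> slice S p) \<noteq> (y \<in> slice S (partner p))) :: nat"
  let ?A = "Pair u ` I"
  have A: "?A \<subseteq> P"
    using u by (auto simp: in_P_iff)
  have empty: "slice S (partner p) = {}" if "p \<in> ?A" for p
  proof -
    have p: "p \<in> P" "fst p = u"
      using that A by auto
    then have "fst (partner p) \<in> mverts M" "fst (partner p) \<noteq> u"
      using partner_in_P[of p] fst_partner[of p] by (auto simp: in_P_iff)
    then show ?thesis
      using tsize_0_slice[OF S] others partner_in_P p by blast
  qed
  have disj: "?A \<inter> partner ` ?A = {}"
  proof (rule equals0I)
    fix q assume q: "q \<in> ?A \<inter> partner ` ?A"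
    then obtain p where p: "p \<in> ?A" "q = partner p"
      by blast
    then have "fst q \<noteq> fst p"
      using A fst_partner[of p] by blast
    moreover have "q \<in> ?A"
      using q by blast
    then have "fst q = u"
      by auto
    moreover have "fst p = u"
      using p(1) by auto
    ultimately show False
      by simp
  qed
  have inj: "inj_on partner ?A"
    using bij_partner A unfolding bij_betw_def by (metis inj_on_subset)
  have re: "sum g ?A = (\<Sum>i\<in>I. g (u, i))" for g :: "'u \<times> nat \<Rightarrow> nat"
    by (subst sum.reindex) (auto simp: inj_on_def)
  have "tdev S u = (\<Sum>p\<in>?A. of_bool (x \<in> slice S p)) + (\<Sum>p\<in>?A. of_bool (y \<in> slice S p))"
    by (simp only: tdev_def bdev_def sum.distrib re)
  also have "(\<Sum>p\<in>?A. of_bool (x \<in> slice S p)) = sum ?g ?A"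
    using empty by (intro sum.cong) auto
  also have "(\<Sum>p\<in>?A. of_bool (y \<in> slice S p)) = (\<Sum>p\<in>?A. ?g (partner p))"
  proof (rule sum.cong)
    fix p assume p: "p \<in> ?A"
    then have "partner (partner p) = p"
      using A partner_partner by blast
    then show "of_bool (y \<in> slice S p) = ?g (partner p)"
      using empty[OF p] by auto
  qed simp
  also have "(\<Sum>p\<in>?A. ?g (partner p)) = sum ?g (partner ` ?A)"
    by (simp only: sum.reindex[OF inj] o_def)
  also have "sum ?g ?A + sum ?g (partner ` ?A) = sum ?g (?A \<union> partner ` ?A)"
    using disj by (intro sum.union_disjoint[symmetric]) auto
  also have "\<dots> \<le> sum ?g P"
    using A partner_in_P finite_P by (intro sum_mono2) auto
  finally show ?thesis .
qed

text \<open>If some triple costs at least 3, a cut of at most 4 leaves at most 1 for any other, so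
  all others are empty and the links from this triple complete the cost to 5. Otherwise each triple
  contains at most one vertex, at cost at least 2, which makes 6 for three vertices.\<close>

lemma all_sparse_cut:
  assumes S: "S \<subseteq> verts T" and size: "3 \<le> card S"
    and sparse: "\<And>u. u \<in> mverts M \<Longrightarrow> sparse S u"
  shows "5 \<le> card (boundary T S)"
proof (rule ccontr)
  assume "\<not> 5 \<le> card (boundary T S)"
  then have d: "(\<Sum>u\<in>mverts M. tcost S u) +
    (\<Sum>p\<in>P. of_bool ((x \<in> slice S p) \<noteq> (y \<in> slice S (partner p)))) \<le> 4"
    using boundary_T_split[of S] by linarith
  show False
  proof (cases "\<exists>u\<in>mverts M. 3 \<le> tcost S u")
    case True
    then obtain u where u: "u \<in> mverts M" "3 \<le> tcost S u"
      by blast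
    have others: "tsize S u' = 0" if "u' \<in> mverts M" "u' \<noteq> u" for u'
    proof -
      have "tcost S u + tcost S u' = sum (tcost S) {u, u'}"
        using that by simp
      also have "\<dots> \<le> sum (tcost S) (mverts M)"
        using u that finite_mverts by (intro sum_mono2) auto
      finally have "tcost S u' \<le> 1"
        using d u by linarith
      then show ?thesis
        using sparse[OF that(1)] by (auto simp: sparse_def)
    qed
    have "card S = tsize S u + (\<Sum>u'\<in>mverts M - {u}. tsize S u')"
      unfolding card_eq_sum_tsize[OF S] using finite_mverts u by (intro sum.remove) auto
    also have "(\<Sum>u'\<in>mverts M - {u}. tsize S u') = 0"
      using others by auto
    finally have "3 \<le> tsize S u"
      using size by simp
    then have "5 \<le> tcost S u + tdev S u"
      using sparse[OF u(1)] by (simp add: sparse_def)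
    moreover have "tcost S u \<le> (\<Sum>u\<in>mverts M. tcost S u)"
      using u finite_mverts by (intro member_le_sum) auto
    ultimately show False
      using d links_ge_tdev[OF S u(1) others] by linarith
  next
    case False
    have "2 * tsize S u \<le> tcost S u" if "u \<in> mverts M" for u
    proof -
      have "tsize S u < 2"
        using False sparse[OF that] that unfolding sparse_def by (metis not_le)
      then show ?thesis
        using sparse[OF that] unfolding sparse_def by (cases "tsize S u = 0") auto
    qed
    then have "2 * card S \<le> (\<Sum>u\<in>mverts M. tcost S u)"
      unfolding card_eq_sum_tsize[OF S] sum_distrib_left by (intro sum_mono) auto
    then show False
      using size d by linarith
  qed
qed

text \<open>Deleting the edges of \<open>M\<close> assigned to these bricks separates
  \<open>A\<close> from the rest, so there cannot be fewer than three.\<close>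

lemma crossing_slots:
  assumes A: "A \<subseteq> mverts M" "A \<noteq> {}" "A \<noteq> mverts M"
  shows "3 \<le> card {p \<in> P. fst p \<in> A \<and> fst (partner p) \<notin> A}" (is "3 \<le> card ?X")
proof (rule ccontr)
  assume less: "\<not> 3 \<le> card ?X"
  let ?C = "edge_of ` ?X"
  let ?R = "{(c, d). \<exists>f\<in>medges (M\<lparr>medges := medges M - ?C\<rparr>). ends (M\<lparr>medges := medges M - ?C\<rparr>) f = {c, d}}"
  have "card ?C \<le> card ?X"
    using finite_P by (intro card_image_le) auto
  then have "card ?C < 3" "?C \<subseteq> medges M"
    using less edge_of_incident by auto
  then have conn: "mconnected (M\<lparr>medges := medges M - ?C\<rparr>)"
    using M(2) unfolding edge_connected_def by blast
  obtain a b where ab: "a \<in> A" "b \<in> mverts M" "b \<notin> A"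
    using A by blast
  then have "(a, b) \<in> ?R\<^sup>*"
    using conn A unfolding mconnected_def by auto
  \<comment> \<open>Membership in \<open>A\<close> spreads along every remaining edge: one leaving
    \<open>A\<close> at \<open>c\<close> would be assigned to a brick at \<open>c\<close> and hence
    be deleted.\<close>
  then have "b \<in> A"
  proof (induction rule: rtrancl_induct)
    case (step c d)
    then obtain f where f: "f \<in> medges M" "f \<notin> ?C" "ends M f = {c, d}"
      by auto
    show ?case
    proof (rule ccontr)
      assume d: "d \<notin> A"
      have c: "c \<in> mverts M"
        using step A by blast
      then have "f \<in> \<sigma> c ` I"
        using assign_bij[OF c] f by (auto simp: bij_betw_def incident_edges_def)
      then obtain i where i: "i \<in> I" "\<sigma> c i = f"
        by blast
      then have p: "(c, i) \<in> P" "edge_of (c, i) = f"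
        using c by (auto simp: in_P_iff edge_of_def)
      then have "{c, d} = {c, fst (partner (c, i))}"
        using ends_is_partner[OF is_partner_partner[OF p(1)]] f by simp
      then have "fst (partner (c, i)) = d"
        by (auto simp: doubleton_eq_iff)
      then have "(c, i) \<in> ?X"
        using p d step by simp
      then show False
        using f p by blast
    qed
  qed (use ab in simp)
  then show False
    using ab by simp
qed

text \<open>Compare \<open>S\<close> with the union of the full triples over \<open>A\<close>. The
  ends of linking edges on which they disagree, counted by \<open>?X\<close> and \<open>?Y\<close>,
  are at most the cost inside the triples by sparseness, so the cut of \<open>S\<close> is at least
  that of the union.\<close>

lemma mixed_cut:
  assumes S: "S \<subseteq> verts T" and A: "A \<subseteq> mverts M" "A \<noteq> {}" "A \<noteq> mverts M"
    and out: "\<And>u. u \<in> mverts M \<Longrightarrow> u \<notin> A \<Longrightarrow> sparse S u"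
    and "in": "\<And>u. u \<in> A \<Longrightarrow> sparse (verts T - S) u"
  shows "6 \<le> card (boundary T S)"
proof -
  let ?g = "\<lambda>p. of_bool ((x \<in> slice S p) \<noteq> (y \<in> slice S (partner p))) :: nat"
  let ?X = "\<lambda>p. of_bool ((x \<in> slice S p) \<noteq> (fst p \<in> A)) :: nat"
  let ?Y = "\<lambda>p. of_bool ((y \<in> slice S p) \<noteq> (fst p \<in> A)) :: nat"
  have dev: "(\<Sum>i\<in>I. ?X (u, i) + ?Y (u, i)) \<le> tcost S u" if u: "u \<in> mverts M" for u
  proof (cases "u \<in> A")
    case True
    have "(\<Sum>i\<in>I. ?X (u, i) + ?Y (u, i)) = tdev (verts T - S) u"
      unfolding tdev_def bdev_def
    proof (rule sum.cong)
      fix i assume "i \<in> I"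
      then have "(u, i) \<in> P"
        using u by (simp add: in_P_iff)
      then show "?X (u, i) + ?Y (u, i) =
        of_bool (x \<in> slice (verts T - S) (u, i)) + of_bool (y \<in> slice (verts T - S) (u, i))"
        using True far xy_verts by (simp add: slice_compl)
    qed simp
    then show ?thesis
      using "in"[OF True] tcost_compl[OF u, of S] by (simp add: sparse_def)
  next
    case False
    then have "(\<Sum>i\<in>I. ?X (u, i) + ?Y (u, i)) = tdev S u"
      unfolding tdev_def bdev_def by simp
    then show ?thesis
      using out[OF u False] by (simp add: sparse_def)
  qed
  have fst_partner_mverts: "fst (partner p) \<in> mverts M" if "p \<in> P" for p
    using partner_in_P[OF that] by (simp add: in_P_iff)
  have reY: "(\<Sum>p\<in>P. ?Y (partner p)) = sum ?Y P"
    by (rule sum.reindex_bij_betw[OF bij_partner])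
  \<comment> \<open>Each edge of \<open>M\<close> leaving \<open>A\<close> carries two linking
    edges, one indexed at either end; this doubles the bound 3 to 6.\<close>
  let ?A1 = "{p \<in> P. fst p \<in> A \<and> fst (partner p) \<notin> A}"
  let ?A2 = "{p \<in> P. fst p \<in> mverts M - A \<and> fst (partner p) \<notin> mverts M - A}"
  have "3 \<le> card ?A1" "3 \<le> card ?A2"
    using crossing_slots[OF A] crossing_slots[of "mverts M - A"] A by auto
  moreover have "card (?A1 \<union> ?A2) = card ?A1 + card ?A2"
    using finite_P by (intro card_Un_disjoint) auto
  moreover have "card (?A1 \<union> ?A2) \<le> card {p \<in> P. (fst p \<in> A) \<noteq> (fst (partner p) \<in> A)}"
    using finite_P fst_partner_mverts by (intro card_mono) auto
  ultimately have "6 \<le> card {p \<in> P. (fst p \<in> A) \<noteq> (fst (partner p) \<in> A)}"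
    by linarith
  also have "\<dots> = (\<Sum>p\<in>P. of_bool ((fst p \<in> A) \<noteq> (fst (partner p) \<in> A)))"
    by (rule card_eq_sum_of_bool[OF finite_P])
  \<comment> \<open>Triangle inequality: if the union of triples cuts \<open>link p\<close> but
    \<open>S\<close> does not, the two disagree at an end of \<open>link p\<close>.\<close>
  also have "\<dots> \<le> (\<Sum>p\<in>P. ?g p + ?X p + ?Y (partner p))"
    by (rule sum_mono) auto
  also have "\<dots> = sum ?g P + sum ?X P + sum ?Y P"
    by (simp only: sum.distrib reY)
  also have "\<dots> = sum ?g P + (\<Sum>u\<in>mverts M. \<Sum>i\<in>I. ?X (u, i) + ?Y (u, i))"
    by (simp only: sum_P sum.distrib add.assoc)
  also have "\<dots> \<le> sum ?g P + (\<Sum>u\<in>mverts M. tcost S u)"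
    using dev by (intro add_left_mono sum_mono)
  also have "\<dots> = card (boundary T S)"
    unfolding boundary_T_split by (simp only: add.commute)
  finally show ?thesis .
qed

lemma cut_T_ge_5:
  assumes S: "S \<subseteq> verts T" "3 \<le> card S" "3 \<le> card (verts T - S)"
  shows "5 \<le> card (boundary T S)"
proof -
  let ?A = "{u \<in> mverts M. \<not> sparse S u}"
  have "in": "sparse (verts T - S) u" if "u \<in> ?A" for u
    using sparse_or_compl[OF S(1)] that by blast
  consider "?A = {}" | "?A = mverts M" | "?A \<noteq> {}" "?A \<noteq> mverts M"
    by blast
  then show ?thesis
  proof cases
    case 1
    then show ?thesis
      using all_sparse_cut[OF S(1,2)] by blast
  next
    case 2
    then have "5 \<le> card (boundary T (verts T - S))"
      using all_sparse_cut[of "verts T - S"] S(3) "in" by blast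
    then show ?thesis
      by (simp add: boundary_compl[OF simple_T])
  next
    case 3
    then have "6 \<le> card (boundary T S)"
      using mixed_cut[OF S(1) _ 3] "in" by blast
    then show ?thesis
      by simp
  qed
qed

lemma cyclically_5_connected_T: "cyclically_connected 5 T"
proof -
  have "5 \<le> card C" if C: "cyclic_edge_cut T C" for C
  proof -
    obtain S where S: "S \<subseteq> verts T" "3 \<le> card S" "3 \<le> card (verts T - S)" "boundary T S \<subseteq> C"
      using cyclic_edge_cut_imp_boundary[OF simple_T C] by blast
    have "finite C"
      using C simple_graph_finite_edges[OF simple_T] finite_subset by (auto simp: cyclic_edge_cut_def)
    then show ?thesis
      using cut_T_ge_5[OF S(1-3)] card_mono[OF _ S(4)] by linarith
  qed
  then show ?thesis
    using cubic_T unfolding cyclically_connected_def by (metis not_le)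
qed

section \<open>Hamiltonian cycles of the construction\<close>

text \<open>The analogue of \<open>sum_edges_T_at_copy\<close> for a vertex set of one brick. Hub
  and linking edges leave the brick, so they are cut as soon as their end in the brick lies in
  \<open>Q\<close>.\<close>

lemma sum_edges_T_crossing_copy:
  fixes h :: "('a, 'u) tvertex set \<Rightarrow> nat"
  assumes q: "q \<in> P"
  shows "(\<Sum>f\<in>edges T. h f * of_bool (crosses (bcopy q ` Q) f)) =
    (\<Sum>f\<in>brick_edges. h (bcopy q ` f) * of_bool (crosses Q f)) +
    (\<Sum>j\<in>I. h (hub_edge q j) * of_bool (w j \<in> Q)) +
    h (link q) * of_bool (x \<in> Q) + h (link (partner q)) * of_bool (y \<in> Q)"
proof -
  have 1: "(\<Sum>p\<in>P. \<Sum>f\<in>brick_edges. h (bcopy p ` f) * of_bool (crosses (bcopy q ` Q) (bcopy p ` f))) =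
      (\<Sum>p\<in>P. if q = p then \<Sum>f\<in>brick_edges. h (bcopy p ` f) * of_bool (crosses Q f) else 0)"
  proof (rule sum.cong)
    fix p assume "p \<in> P"
    have "crosses (bcopy q ` Q) (bcopy p ` f) \<longleftrightarrow> q = p \<and> crosses Q f" for f
      by (auto simp: crosses_def)
    then show "(\<Sum>f\<in>brick_edges. h (bcopy p ` f) * of_bool (crosses (bcopy q ` Q) (bcopy p ` f))) =
      (if q = p then \<Sum>f\<in>brick_edges. h (bcopy p ` f) * of_bool (crosses Q f) else 0)"
      by simp
  qed simp
  have 2: "(\<Sum>p\<in>P. \<Sum>j\<in>I. h (hub_edge p j) * of_bool (crosses (bcopy q ` Q) (hub_edge p j))) =
      (\<Sum>p\<in>P. if q = p then \<Sum>j\<in>I. h (hub_edge p j) * of_bool (w j \<in> Q) else 0)"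
  proof (rule sum.cong)
    fix p assume "p \<in> P"
    have "crosses (bcopy q ` Q) (hub_edge p j) \<longleftrightarrow> q = p \<and> w j \<in> Q" for j
      by (auto simp: hub_edge_def)
    then show "(\<Sum>j\<in>I. h (hub_edge p j) * of_bool (crosses (bcopy q ` Q) (hub_edge p j))) =
      (if q = p then \<Sum>j\<in>I. h (hub_edge p j) * of_bool (w j \<in> Q) else 0)"
      by simp
  qed simp
  have 3: "(\<Sum>p\<in>P. h (link p) * of_bool (crosses (bcopy q ` Q) (link p))) =
      (\<Sum>p\<in>P. (if q = p then h (link p) * of_bool (x \<in> Q) else 0) +
        (if partner q = p then h (link p) * of_bool (y \<in> Q) else 0))"
  proof (rule sum.cong)
    fix p assume p: "p \<in> P"
    have "crosses (bcopy q ` Q) (link p) \<longleftrightarrow> (p = q \<and> x \<in> Q) \<noteq> (partner p = q \<and> y \<in> Q)"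
      by (simp only: link_def crosses_doubleton bcopy_in_image_iff)
    then show "h (link p) * of_bool (crosses (bcopy q ` Q) (link p)) =
      (if q = p then h (link p) * of_bool (x \<in> Q) else 0) +
        (if partner q = p then h (link p) * of_bool (y \<in> Q) else 0)"
      using partner_eq_iff[OF q p] partner_neq[OF q] partner_neq[OF p] by auto
  qed simp
  show ?thesis
    unfolding sum_edges_T sum.distrib 1 2 3 sum.delta'[OF finite_P] sum.delta[OF finite_P]
    using q partner_in_P[OF q] by (simp only: if_True)
qed

section \<open>How a hamiltonian cycle leaves a brick\<close>

definition hub_count :: "('a, 'u) tvertex set set \<Rightarrow> 'u \<times> nat \<Rightarrow> nat" where
  "hub_count F q = (\<Sum>j\<in>I. of_bool (hub_edge q j \<in> F))"

definition link_count :: "('a, 'u) tvertex set set \<Rightarrow> 'u \<times> nat \<Rightarrow> nat" where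
  "link_count F q = of_bool (link q \<in> F) + of_bool (link (partner q) \<in> F)"

text \<open>The edge set \<open>F\<close> can leave the copy of \<open>Q\<close> only through the two linking edges.\<close>

definition sealed :: "('a, 'u) tvertex set set \<Rightarrow> 'u \<times> nat \<Rightarrow> 'a set \<Rightarrow> bool" where
  "sealed F q Q \<longleftrightarrow> (\<forall>f\<in>brick_edges. bcopy q ` f \<in> F \<longrightarrow> \<not> crosses Q f) \<and>
     (\<forall>j\<in>I. hub_edge q j \<in> F \<longrightarrow> w j \<notin> Q)"

lemma link_count_partner: "q \<in> P \<Longrightarrow> link_count F (partner q) = link_count F q"
  by (simp add: link_count_def partner_partner)

lemma card_ham_crossing:
  assumes F: "ham_edges T F" and q: "q \<in> P"
  shows "card {f \<in> F. crosses (bcopy q ` Q) f} =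
    (\<Sum>f\<in>brick_edges. of_bool (bcopy q ` f \<in> F) * of_bool (crosses Q f)) +
    (\<Sum>j\<in>I. of_bool (hub_edge q j \<in> F) * of_bool (w j \<in> Q)) +
    of_bool (link q \<in> F) * of_bool (x \<in> Q) + of_bool (link (partner q) \<in> F) * of_bool (y \<in> Q)"
proof -
  have "{f \<in> F. crosses (bcopy q ` Q) f} = {f \<in> edges T. f \<in> F \<and> crosses (bcopy q ` Q) f}"
    using F by (auto simp: ham_edges_def)
  then have "card {f \<in> F. crosses (bcopy q ` Q) f} =
    (\<Sum>f\<in>edges T. of_bool (f \<in> F) * of_bool (crosses (bcopy q ` Q) f))"
    by (simp only: card_eq_sum_of_bool[OF simple_graph_finite_edges[OF simple_T]] of_bool_conj)
  then show ?thesis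
    by (simp only: sum_edges_T_crossing_copy[OF q])
qed

lemma card_ham_degree:
  assumes F: "ham_edges T F" and a: "a \<in> verts T"
  shows "(\<Sum>f\<in>edges T. of_bool (f \<in> F) * of_bool (a \<in> f)) = (2 :: nat)"
proof -
  have "{f \<in> F. a \<in> f} = {f \<in> edges T. f \<in> F \<and> a \<in> f}"
    using F by (auto simp: ham_edges_def)
  moreover have "card {f \<in> F. a \<in> f} = 2"
    using F a by (auto simp: ham_edges_def)
  ultimately show ?thesis
    by (simp only: card_eq_sum_of_bool[OF simple_graph_finite_edges[OF simple_T]] of_bool_conj)
qed

lemma brick_image_subset: "q \<in> P \<Longrightarrow> Q \<subseteq> verts G - {v} \<Longrightarrow> bcopy q ` Q \<subseteq> verts T"
  using bcopy_in_verts[of q] by auto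

lemma brick_image_crossed:
  assumes F: "ham_edges T F" and q: "q \<in> P" and Q: "Q \<subseteq> verts G - {v}" "Q \<noteq> {}"
  shows "card {f \<in> F. crosses (bcopy q ` Q) f} \<noteq> 0"
proof -
  have "Hub (fst q) 1 \<in> verts T" "Hub (fst q) 1 \<notin> bcopy q ` Q"
    using q by (auto simp: Hub_in_verts in_P_iff I_def)
  then have "bcopy q ` Q \<noteq> verts T"
    by blast
  then have "\<exists>f\<in>F. crosses (bcopy q ` Q) f"
    using F brick_image_subset[OF q Q(1)] Q(2) unfolding ham_edges_def by simp
  moreover have "finite F"
    using F finite_subset[OF _ simple_graph_finite_edges[OF simple_T]] by (simp add: ham_edges_def)
  ultimately show ?thesis
    by auto
qed

text \<open>The sum counts the edges of \<open>F\<close> that leave the whole brick, and a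
  hamiltonian cycle crosses every proper cut a positive even number of times.\<close>

lemma hub_count_link_count:
  assumes F: "ham_edges T F" and q: "q \<in> P"
  shows "even (hub_count F q + link_count F q)" "hub_count F q + link_count F q \<noteq> 0"
proof -
  let ?B = "verts G - {v}"
  have "card {f \<in> F. crosses (bcopy q ` ?B) f} = hub_count F q + link_count F q"
  proof -
    have "(\<Sum>f\<in>brick_edges. of_bool (bcopy q ` f \<in> F) * of_bool (crosses ?B f)) = (0 :: nat)"
      using brick_edge(4) by (intro sum.neutral) (simp add: crosses_def)
    moreover have "(\<Sum>j\<in>I. of_bool (hub_edge q j \<in> F) * of_bool (w j \<in> ?B)) = hub_count F q"
      unfolding hub_count_def using w_verts w_neq_v by (intro sum.cong) auto
    moreover have "x \<in> ?B" "y \<in> ?B"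
      using far xy_verts by auto
    ultimately show ?thesis
      unfolding card_ham_crossing[OF F q] link_count_def by simp
  qed
  moreover have "even (card {f \<in> F. crosses (bcopy q ` ?B) f})"
    by (rule ham_edges_even_boundary[OF simple_T F brick_image_subset[OF q subset_refl]])
  moreover have "card {f \<in> F. crosses (bcopy q ` ?B) f} \<noteq> 0"
    using far xy_verts by (intro brick_image_crossed[OF F q]) auto
  ultimately show "even (hub_count F q + link_count F q)" "hub_count F q + link_count F q \<noteq> 0"
    by simp_all
qed

text \<open>The hub count is 0 or 2. If it is 0, the whole brick is sealed and \<open>F\<close> must
  leave it by linking edges. If it is 2, a part of the brick cut off from \<open>v\<close> is found
  by carrying \<open>F\<close> back to \<open>G\<close>.\<close>

lemma even_hub_count_sealed:
  assumes nonham: "\<not> hamiltonian G" and F: "ham_edges T F" and q: "q \<in> P"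
    and even: "even (hub_count F q)"
  shows "link_count F q = 2 \<and> (\<exists>Q\<subseteq>verts G - {v}. x \<in> Q \<and> y \<in> Q \<and> sealed F q Q)"
proof -
  let ?B = "verts G - {v}"
  have ev: "even (link_count F q)"
    using hub_count_link_count(1)[OF F q] even by simp
  have links: "link q \<in> F \<longleftrightarrow> link_count F q = 2" "link (partner q) \<in> F \<longleftrightarrow> link_count F q = 2"
    using ev by (auto simp: link_count_def)
  have link02: "link_count F q = 0 \<or> link_count F q = 2"
    using ev by (auto simp: link_count_def)
  have "hub_count F q \<le> card I"
    unfolding hub_count_def card_eq_sum by (intro sum_mono) auto
  then have "hub_count F q \<le> 3"
    by simp
  then consider "hub_count F q = 0" | "hub_count F q = 2"
    using even by (auto simp: numeral_3_eq_3 le_Suc_eq)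
  then show ?thesis
  proof cases
    case 1
    then have "link_count F q = 2"
      using hub_count_link_count(2)[OF F q] link02 by simp
    moreover have "sealed F q ?B"
      using 1 brick_edge(4) unfolding sealed_def hub_count_def by (auto simp: crosses_def)
    ultimately show ?thesis
      using far xy_verts by blast
  next
    case 2
    \<comment> \<open>Contracting the rest of the construction to \<open>v\<close> and the two linking edges to \<open>{x, y}\<close>
      turns \<open>F\<close> into a 2-regular edge set of \<open>G\<close>; it is disconnected as \<open>G\<close> is not hamiltonian.\<close>
    define F' where "F' = {f \<in> brick_edges. bcopy q ` f \<in> F} \<union>
      (\<lambda>j. {v, w j}) ` {j \<in> I. hub_edge q j \<in> F} \<union> {f. f = {x, y} \<and> link_count F q = 2}"
    have sub: "F' \<subseteq> edges G"
      using xy vw_edge brick_edge(1) by (auto simp: F'_def)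
    have mem1: "f \<in> F' \<longleftrightarrow> bcopy q ` f \<in> F" if "f \<in> brick_edges" for f
      using brick_edge(2,3)[OF that] that by (auto simp: F'_def)
    have mem2: "{v, w j} \<in> F' \<longleftrightarrow> hub_edge q j \<in> F" if "j \<in> I" for j
      using brick_edge(2)[of "{v, w j}"] far w_inj[OF that] w_neq_v[OF that] that by (auto simp: F'_def doubleton_eq_iff)
    have mem3: "{x, y} \<in> F' \<longleftrightarrow> link_count F q = 2"
    proof -
      have 1: "{x, y} \<notin> brick_edges"
        using brick_edge(3) by blast
      have 2: "{x, y} \<notin> (\<lambda>j. {v, w j}) ` J" for J
      proof
        assume "{x, y} \<in> (\<lambda>j. {v, w j}) ` J"
        then obtain j where "{x, y} = {v, w j}"
          by (rule imageE)
        then show False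
          using far(1,2) by (simp only: doubleton_eq_iff) blast
      qed
      show ?thesis
        by (simp only: F'_def Un_iff mem_Collect_eq 1 2 simp_thms)
    qed
    have card_F': "card {f \<in> F'. R f} = (\<Sum>f\<in>edges G. of_bool (f \<in> F') * of_bool (R f))" for R
    proof -
      have "{f \<in> F'. R f} = {f \<in> edges G. f \<in> F' \<and> R f}"
        using sub by blast
      then show ?thesis
        by (simp only: card_eq_sum_of_bool[OF finite_E] of_bool_conj)
    qed
    have brick_sum: "(\<Sum>f\<in>brick_edges. of_bool (f \<in> F') * g f) =
      (\<Sum>f\<in>brick_edges. of_bool (bcopy q ` f \<in> F) * g f)" for g :: "'a set \<Rightarrow> nat"
      by (rule sum.cong) (simp_all add: mem1)
    have hub_sum: "(\<Sum>j\<in>I. of_bool ({v, w j} \<in> F') * g j) =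
      (\<Sum>j\<in>I. of_bool (hub_edge q j \<in> F) * g j)" for g :: "nat \<Rightarrow> nat"
      by (rule sum.cong) (simp_all add: mem2)
    \<comment> \<open>At \<open>v\<close> the degree is the hub count 2. Elsewhere it equals the
      \<open>F\<close>-degree of the copy term by term, as \<open>{x, y}\<close> is in
      \<open>F'\<close> exactly when both linking edges are in \<open>F\<close>, and otherwise
      neither is.\<close>
    have deg: "card {f \<in> F'. c \<in> f} = 2" if c: "c \<in> verts G" for c
    proof (cases "c = v")
      case True
      show ?thesis
        unfolding card_F' True sum_edges_G_at_v using hub_sum[of "\<lambda>_. 1"] 2
        by (simp add: hub_count_def del: sum_of_bool_eq sum_of_bool_mult_eq)
    next
      case False
      have "(\<Sum>f\<in>edges G. of_bool (f \<in> F') * of_bool (c \<in> f)) =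
        (\<Sum>f\<in>edges T. of_bool (f \<in> F) * of_bool (bcopy q c \<in> f) :: nat)"
        unfolding sum_edges_G_at[OF False] sum_edges_T_at_copy[OF q] brick_sum hub_sum mem3 links ..
      also have "\<dots> = 2"
        using False c q by (intro card_ham_degree[OF F]) (simp add: bcopy_in_verts)
      finally show ?thesis
        unfolding card_F' .
    qed
    have "\<not> ham_edges G F'"
      using ham_edges_imp_hamiltonian[OF sG, of F'] nonham v by blast
    then obtain S where S: "S \<subseteq> verts G" "S \<noteq> {}" "S \<noteq> verts G" "\<And>f. f \<in> F' \<Longrightarrow> \<not> crosses S f"
      using sub deg unfolding ham_edges_def by blast
    \<comment> \<open>The side of the uncrossed cut that avoids \<open>v\<close>, so that it lies in
      the brick.\<close>
    define Q where "Q = (if v \<in> S then verts G - S else S)"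
    have Q: "Q \<subseteq> ?B" "Q \<noteq> {}"
      using S by (auto simp: Q_def)
    have unc: "\<not> crosses Q f" if "f \<in> F'" for f
    proof -
      have "boundary G Q = boundary G S"
        by (simp add: Q_def boundary_compl[OF sG])
      moreover have "f \<notin> boundary G S" "f \<in> edges G"
        using S(4)[OF that] sub that by (auto simp: boundary_def)
      ultimately show ?thesis
        by (auto simp: boundary_def)
    qed
    have sealed: "sealed F q Q"
    proof -
      have "w j \<notin> Q" if "j \<in> I" "hub_edge q j \<in> F" for j
        using unc[of "{v, w j}"] mem2 that Q by auto
      then show ?thesis
        using unc mem1 by (auto simp: sealed_def)
    qed
    then have "(\<Sum>f\<in>brick_edges. of_bool (bcopy q ` f \<in> F) * of_bool (crosses Q f)) = (0 :: nat)"
      "(\<Sum>j\<in>I. of_bool (hub_edge q j \<in> F) * of_bool (w j \<in> Q)) = (0 :: nat)"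
      unfolding sealed_def by (auto intro!: sum.neutral)
    \<comment> \<open>In the construction \<open>F\<close> does leave the copy of \<open>Q\<close>,
      but not by brick or hub edges; so a linking edge is used.\<close>
    then have "of_bool (link q \<in> F) * of_bool (x \<in> Q) +
      of_bool (link (partner q) \<in> F) * of_bool (y \<in> Q) \<noteq> (0 :: nat)"
      using brick_image_crossed[OF F q Q] unfolding card_ham_crossing[OF F q] by linarith
    then have two: "link_count F q = 2" and "x \<in> Q \<or> y \<in> Q"
      using links by (auto split: if_splits)
    moreover have "x \<in> Q \<longleftrightarrow> y \<in> Q"
      using unc[of "{x, y}"] mem3 two by simp
    ultimately show ?thesis
      using Q(1) sealed by blast
  qed
qed

lemma mverts_nonempty: "mverts M \<noteq> {}"
  using M(2) by (auto simp: edge_connected_def mconnected_def)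

lemma nonhamiltonian_T:
  assumes nonham: "\<not> hamiltonian G"
  shows "\<not> hamiltonian T"
proof
  assume "hamiltonian T"
  then obtain F where F: "ham_edges T F"
    using hamiltonian_imp_ham_edges by blast
  obtain u where u: "u \<in> mverts M"
    using mverts_nonempty by blast
  \<comment> \<open>Double counting of the hub edges in \<open>F\<close>: three hubs of degree 2
    give 6, which is not a sum of three odd numbers.\<close>
  have "(\<Sum>i\<in>I. hub_count F (u, i)) = (\<Sum>j\<in>I. \<Sum>i\<in>I. of_bool (hub_edge (u, i) j \<in> F))"
    unfolding hub_count_def by (rule sum.swap)
  also have "\<dots> = (\<Sum>j\<in>I. 2)"
  proof (rule sum.cong)
    fix j assume j: "j \<in> I"
    then have "Hub u j \<in> verts T"
      using u by (simp add: Hub_in_verts)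
    from card_ham_degree[OF F this]
    show "(\<Sum>i\<in>I. of_bool (hub_edge (u, i) j \<in> F)) = (2 :: nat)"
      unfolding sum_edges_T_at_Hub[OF u j] .
  qed simp
  also have "\<dots> = 6"
    by simp
  finally have sum6: "hub_count F (u, 1) + hub_count F (u, 2) + hub_count F (u, 3) = 6"
    by (simp only: sum_I)
  have "\<exists>i\<in>I. even (hub_count F (u, i))"
  proof (rule ccontr)
    assume "\<not> ?thesis"
    then have "odd (hub_count F (u, 1) + hub_count F (u, 2) + hub_count F (u, 3))"
      by (simp add: I_def)
    then show False
      unfolding sum6 by simp
  qed
  then obtain i where i: "i \<in> I" "even (hub_count F (u, i))"
    by blast
  define q where "q = (u, i)"
  define r where "r = partner q"
  have q: "q \<in> P" and r: "r \<in> P"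
    using u i partner_in_P by (auto simp: q_def r_def in_P_iff)
  have rq: "partner r = q" "r \<noteq> q"
    using q partner_partner partner_neq by (auto simp: r_def)
  obtain Q where "link_count F q = 2" and Q: "Q \<subseteq> verts G - {v}" "x \<in> Q" "y \<in> Q" "sealed F q Q"
    using even_hub_count_sealed[OF nonham F q] i by (auto simp: q_def)
  \<comment> \<open>Partner bricks share their two linking edges, so evenness of the hub count
    passes from \<open>q\<close> to \<open>r\<close>.\<close>
  then have "link_count F r = 2"
    using link_count_partner[OF q, of F] by (simp add: r_def)
  then have "even (hub_count F r)"
    using hub_count_link_count(1)[OF F r] by simp
  then obtain R where R: "R \<subseteq> verts G - {v}" "x \<in> R" "y \<in> R" "sealed F r R"
    using even_hub_count_sealed[OF nonham F r] by blast
  \<comment> \<open>Both linking edges join the two sealed sets, so no edge of \<open>F\<close> leaves their union.\<close>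
  let ?S = "bcopy q ` Q \<union> bcopy r ` R"
  have "?S \<subseteq> verts T"
    using brick_image_subset[OF q Q(1)] brick_image_subset[OF r R(1)] by simp
  moreover have "?S \<noteq> {}"
    using Q by blast
  moreover have "?S \<noteq> verts T"
  proof -
    have "Hub u 1 \<in> verts T" "Hub u 1 \<notin> ?S"
      using u by (auto simp: Hub_in_verts I_def)
    then show ?thesis
      by blast
  qed
  ultimately obtain f where f: "f \<in> F" "crosses ?S f"
    using F unfolding ham_edges_def by blast
  then have "f \<in> edges T"
    using F by (auto simp: ham_edges_def)
  then consider p f' where "p \<in> P" "f' \<in> brick_edges" "f = bcopy p ` f'"
    | p j where "p \<in> P" "j \<in> I" "f = hub_edge p j" | p where "p \<in> P" "f = link p"
    unfolding edges_T by blast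
  then show False
  proof cases
    case 1
    have "p = q \<and> crosses Q f' \<or> p = r \<and> crosses R f'"
      using f(2) rq unfolding 1(3) crosses_def by auto
    then show False
      using Q(4) R(4) 1 f(1) unfolding sealed_def by blast
  next
    case 2
    have "p = q \<and> w j \<in> Q \<or> p = r \<and> w j \<in> R"
      using f(2) unfolding 2(3) hub_edge_def by auto
    then show False
      using Q(4) R(4) 2 f(1) unfolding sealed_def by blast
  next
    case 3
    have "p = q \<or> p = r \<or> partner p = q \<or> partner p = r"
      using f(2) unfolding 3(2) link_def by auto
    then have "p = q \<or> p = r"
      using partner_eq_iff[OF 3(1) q] partner_eq_iff[OF 3(1) r] rq r_def by auto
    then have "\<not> crosses ?S f"
      using Q R rq unfolding 3(2) link_def by (auto simp: r_def)
    then show False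
      using f(2) by blast
  qed
qed

end

section \<open>From distances to the assumptions of the locale, and the conclusion\<close>

lemma distance_ge_2_nonadjacent:
  assumes "2 \<le> distance G a b" "a \<in> verts G"
  shows "b \<noteq> a" "b \<in> verts G \<Longrightarrow> {a, b} \<notin> edges G"
proof -
  \<comment> \<open>Every walk bounds the distance; the walks \<open>[a]\<close> and
    \<open>[a, b]\<close> would give 0 and 1.\<close>
  have le: "distance G a b \<le> enat (length p - 1)" if "walk G p" "hd p = a" "last p = b" for p
    unfolding distance_def using that by (intro INF_lower) simp
  show "b \<noteq> a"
  proof
    assume "b = a"
    then have "distance G a b \<le> enat (length [a] - 1)"
      using assms(2) by (intro le) (simp_all add: walk_Cons)
    then have "2 \<le> enat (length [a] - 1)"
      by (rule order_trans[OF assms(1)])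
    then show False
      by (simp add: numeral_eq_enat)
  qed
  show "{a, b} \<notin> edges G" if "b \<in> verts G"
  proof
    assume "{a, b} \<in> edges G"
    then have "distance G a b \<le> enat (length [a, b] - 1)"
      using assms(2) that by (intro le) (simp_all add: walk_Cons)
    then have "2 \<le> enat (length [a, b] - 1)"
      by (rule order_trans[OF assms(1)])
    then show False
      by (simp add: numeral_eq_enat)
  qed
qed

theorem theorem2:
  fixes G :: "'a ugraph" and v x y :: 'a and w :: "nat \<Rightarrow> 'a"
    and M :: "('u, 'f) mgraph" and \<sigma> :: "'u \<Rightarrow> nat \<Rightarrow> 'f"
  assumes "cubic_graph G"
    and "cyclically_connected 4 G"
    and "\<not> hamiltonian G"
    and "v \<in> verts G"
    and "bij_betw w {1, 2, 3} (neighbours G v)"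
    and "{x, y} \<in> edges G"
    and "distance G v x \<ge> 3"
    and "distance G v y \<ge> 3"
    and "\<And>C. cyclic_edge_cut G C \<Longrightarrow> card C = 4 \<Longrightarrow>
           (\<forall>c\<in>C. v \<notin> c \<and> x \<notin> c) \<and>
           component (delete_edges G C) v \<noteq> component (delete_edges G C) x"
    and "cubic_multigraph M"
    and "edge_connected 3 M"
    and "brick_assignment M \<sigma>"
  shows "cyclically_connected 5 (triple_graph G v w x y M \<sigma>) \<and>
         \<not> hamiltonian (triple_graph G v w x y M \<sigma>)"
proof -
  have verts: "x \<in> verts G" "y \<in> verts G"
    using simple_graph_edge_verts[of G x y] assms(1,6) by (auto simp: cubic_graph_def)
  have "(2 :: enat) \<le> 3"
    by simp
  then have dist: "2 \<le> distance G v x" "2 \<le> distance G v y"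
    using assms(7,8) by (blast intro: order_trans)+
  interpret triple_construction G v x y w M \<sigma>
    using assms(2,4,5,6,9-12) verts distance_ge_2_nonadjacent[OF dist(1)] distance_ge_2_nonadjacent[OF dist(2)]
    by unfold_locales blast+
  show ?thesis
    using cyclically_5_connected_T nonhamiltonian_T[OF assms(3)] by blast
qed

end
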